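(* Let $T$ be a nonempty set, let $f_t:X\to\overline{\mathbb{R}}$, $t\in T$, be convex functions, and let $f:=\sup_{t\in T}f_t$. Then, for every $x\in X$, $$\partial f(x)=\bigcap_{L\in\mathcal{F}(x)}\operatorname{co}\left\{\bigcap_{\varepsilon>0}\operatorname{cl}^{s}\left(\bigcup_{t\in T_\varepsilon(x)}\partial_\varepsilon\left(f_t+\mathrm{I}_{L\cap\operatorname{dom}f}\right)(x)\right)\right\}.$$ If, in addition, $\operatorname{cl}f=\sup_{t\in T}(\operatorname{cl}f_t)$, then, for every $x\in X$, $$\partial f(x)=\bigcap_{L\in\mathcal{F}(x)}\operatorname{co}\left\{\bigcap_{\varepsilon>0}\operatorname{cl}\left(\bigcup_{t\in T_\varepsilon(x)}\partial_\varepsilon f_t(x)+\mathrm{N}_{L\cap\operatorname{dom}f}(x)\right)\right\}.$$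
   Context: $X$ is a real separated (Hausdorff) locally convex space with topological dual $X^*$; in $X^*$, $\operatorname{cl}$ denotes closure for the $w^*$-topology and $\operatorname{cl}^s$ closure for the strong topology $\beta(X^*,X)$. $\overline{\mathbb{R}}=\mathbb{R}\cup\{\pm\infty\}$, with the convention $(+\infty)+(-\infty)=(-\infty)+(+\infty)=+\infty$. For $h:X\to\overline{\mathbb{R}}$, $\operatorname{dom}h=\{x:h(x)<+\infty\}$, $\operatorname{epi}h=\{(x,\lambda)\in X\times\mathbb{R}:h(x)\le\lambda\}$; $h$ is convex if $\operatorname{epi}h$ is convex; $\operatorname{cl}h$ is the function with $\operatorname{epi}(\operatorname{cl}h)=\operatorname{cl}(\operatorname{epi}h)$. For $\varepsilon\ge0$, $\partial_\varepsilon h(x)=\{x^*\in X^*: h(y)\ge h(x)+\langle x^*,y-x\rangle-\varepsilon\ \forall y\in X\}$ if $h(x)\in\mathbb{R}$, and $\partial_\varepsilon h(x)=\emptyset$ if $h(x)\notin\mathbb{R}$; $\partial h=\partial_0h$. $\mathrm{I}_A$ is the indicator function ($0$ on $A$, $+\infty$ off $A$), $\operatorname{co}$ is the convex hull. The normal cone is $\mathrm{N}_A(x)=\{x^*\in X^*:\langle x^*,z-x\rangle\le0\ \forall z\in A\}$ if $x\in A$, and $\emptyset$ if $x\notin A$. Minkowski sums satisfy $A+\emptyset=\emptyset+A=\emptyset$. $\mathcal{F}(x)$ is the family of finite-dimensional linear subspaces $L\subset X$ containing $x$, and $T_\varepsilon(x)=\{t\in T:f_t(x)\ge f(x)-\varepsilon\}$.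 *)

theory Defs
  imports "HOL-Analysis.Analysis"
begin

text \<open>Convexity is written out in the class axiom because \<^const>\<open>convex\<close> is not
  available on the type variable of a class under definition; the lemma below restates it.\<close>

class locally_convex_space = real_vector + topological_ab_group_add + t2_space +
  assumes tendsto_scaleR_Pair:
      "LIM p (nhds (r::real) \<times>\<^sub>F nhds a). fst p *\<^sub>R snd p :> nhds (r *\<^sub>R a)"
    and convex_neighbourhood_base:
      "open U \<Longrightarrow> 0 \<in> U \<Longrightarrow> \<exists>V. open V \<and> 0 \<in> V \<and> V \<subseteq> U \<and>
         (\<forall>x\<in>V. \<forall>y\<in>V. \<forall>u\<ge>0. \<forall>v\<ge>0. u + v = 1 \<longrightarrow> u *\<^sub>R x + v *\<^sub>R y \<in> V)"

lemma convex_open_base: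
  fixes U :: "'a::locally_convex_space set"
  assumes "open U" "0 \<in> U"
  shows "\<exists>V. open V \<and> convex V \<and> 0 \<in> V \<and> V \<subseteq> U"
  using convex_neighbourhood_base[OF assms] unfolding convex_def by blast

instance real_normed_vector \<subseteq> locally_convex_space
proof
  fix r :: real and a :: 'a
  show "LIM p (nhds r \<times>\<^sub>F nhds a). fst p *\<^sub>R snd p :> nhds (r *\<^sub>R a)"
    by (intro tendsto_scaleR filterlim_fst filterlim_snd)
next
  fix U :: "'a set"
  assume "open U" "0 \<in> U"
  then obtain e where "e > 0" "ball 0 e \<subseteq> U"
    using open_contains_ball by blast
  then show "\<exists>V. open V \<and> 0 \<in> V \<and> V \<subseteq> U \<and>
      (\<forall>x\<in>V. \<forall>y\<in>V. \<forall>u\<ge>0. \<forall>v\<ge>0. u + v = 1 \<longrightarrow> u *\<^sub>R x + v *\<^sub>R y \<in> V)"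
    using convex_ball[of "0::'a" e] unfolding convex_def
    by (intro exI[of _ "ball 0 e"]) auto
qed

text \<open>Boundedness with respect to the vector topology; in a normed space it is
  \<^const>\<open>bounded\<close>.\<close>

definition tvs_bounded :: "'a::locally_convex_space set \<Rightarrow> bool" where
  "tvs_bounded B \<longleftrightarrow>
     (\<forall>U. open U \<and> 0 \<in> U \<longrightarrow> (\<exists>r>0. \<forall>s. r \<le> \<bar>s\<bar> \<longrightarrow> B \<subseteq> (*\<^sub>R) s ` U))"

lemma tvs_bounded_empty: "tvs_bounded {}"
  by (auto simp: tvs_bounded_def intro: exI[of _ 1])

lemma tvs_bounded_Un:
  assumes "tvs_bounded A" "tvs_bounded B"
  shows "tvs_bounded (A \<union> B)"
  unfolding tvs_bounded_def
proof (intro allI impI)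
  fix U :: "'a set"
  assume U: "open U \<and> 0 \<in> U"
  obtain r where r: "r > 0" "\<And>s. r \<le> \<bar>s\<bar> \<Longrightarrow> A \<subseteq> (*\<^sub>R) s ` U"
    using assms(1) U unfolding tvs_bounded_def by blast
  obtain r' where r': "r' > 0" "\<And>s. r' \<le> \<bar>s\<bar> \<Longrightarrow> B \<subseteq> (*\<^sub>R) s ` U"
    using assms(2) U unfolding tvs_bounded_def by blast
  have "A \<union> B \<subseteq> (*\<^sub>R) s ` U" if "max r r' \<le> \<bar>s\<bar>" for s
    using r(2)[of s] r'(2)[of s] that by simp
  then show "\<exists>r>0. \<forall>s. r \<le> \<bar>s\<bar> \<longrightarrow> A \<union> B \<subseteq> (*\<^sub>R) s ` U"
    using r(1) by (intro exI[of _ "max r r'"]) auto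
qed

typedef (overloaded) 'a dual =
  "{\<phi> :: 'a::locally_convex_space \<Rightarrow> real. linear \<phi> \<and> continuous_on UNIV \<phi>}"
  morphisms dual_apply Dual
  by (rule exI[of _ "\<lambda>_. 0"]) (simp add: linear_iff)

setup_lifting type_definition_dual

instantiation dual :: (locally_convex_space) real_vector
begin

lift_definition zero_dual :: "'a dual" is "\<lambda>_. 0"
  by (simp add: linear_iff)

lift_definition plus_dual :: "'a dual \<Rightarrow> 'a dual \<Rightarrow> 'a dual" is "\<lambda>\<phi> \<psi> x. \<phi> x + \<psi> x"
  by (auto simp: linear_iff algebra_simps intro: continuous_on_add)

lift_definition minus_dual :: "'a dual \<Rightarrow> 'a dual \<Rightarrow> 'a dual" is "\<lambda>\<phi> \<psi> x. \<phi> x - \<psi> x"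
  by (auto simp: linear_iff algebra_simps intro: continuous_on_diff)

lift_definition uminus_dual :: "'a dual \<Rightarrow> 'a dual" is "\<lambda>\<phi> x. - \<phi> x"
  by (auto simp: linear_iff algebra_simps intro: continuous_on_minus)

lift_definition scaleR_dual :: "real \<Rightarrow> 'a dual \<Rightarrow> 'a dual" is "\<lambda>c \<phi> x. c * \<phi> x"
  by (auto simp: linear_iff algebra_simps intro: continuous_on_mult_left)

instance
  by standard (transfer, rule ext, simp add: algebra_simps)+

end

definition weak_star_topology :: "'a::locally_convex_space dual topology" where
  "weak_star_topology =
     topology_generated_by {{\<phi>. dual_apply \<phi> x \<in> U} | x U. open U}"

text \<open>The strong topology is that of uniform convergence on the bounded subsets of the space.\<close>

definition strong_open :: "'a::locally_convex_space dual set \<Rightarrow> bool" where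
  "strong_open W \<longleftrightarrow>
     (\<forall>\<phi>\<in>W. \<exists>B. tvs_bounded B \<and>
        (\<exists>e>0. {\<psi>. \<forall>b\<in>B. \<bar>dual_apply \<psi> b - dual_apply \<phi> b\<bar> < e} \<subseteq> W))"

definition strong_topology :: "'a::locally_convex_space dual topology" where
  "strong_topology = topology strong_open"

lemma istopology_strong_open: "istopology strong_open"
  unfolding istopology_def
proof (intro conjI allI impI)
  fix V W :: "'a dual set"
  assume V: "strong_open V" and W: "strong_open W"
  show "strong_open (V \<inter> W)"
    unfolding strong_open_def
  proof
    fix \<phi> assume "\<phi> \<in> V \<inter> W"
    then have "\<phi> \<in> V" "\<phi> \<in> W" by auto
    obtain A d where A: "tvs_bounded A" "d > 0"
      "{\<psi>. \<forall>b\<in>A. \<bar>dual_apply \<psi> b - dual_apply \<phi> b\<bar> < d} \<subseteq> V"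
      using V \<open>\<phi> \<in> V\<close> unfolding strong_open_def by blast
    obtain B e where B: "tvs_bounded B" "e > 0"
      "{\<psi>. \<forall>b\<in>B. \<bar>dual_apply \<psi> b - dual_apply \<phi> b\<bar> < e} \<subseteq> W"
      using W \<open>\<phi> \<in> W\<close> unfolding strong_open_def by blast
    have "{\<psi>. \<forall>b\<in>A \<union> B. \<bar>dual_apply \<psi> b - dual_apply \<phi> b\<bar> < min d e} \<subseteq> V \<inter> W"
      using A(3) B(3) by fastforce
    moreover have "min d e > 0"
      using A(2) B(2) by simp
    ultimately show "\<exists>B. tvs_bounded B \<and>
        (\<exists>e>0. {\<psi>. \<forall>b\<in>B. \<bar>dual_apply \<psi> b - dual_apply \<phi> b\<bar> < e} \<subseteq> V \<inter> W)"
      using tvs_bounded_Un[OF A(1) B(1)] by blast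
  qed
next
  fix \<K> :: "'a dual set set"
  assume "\<forall>K\<in>\<K>. strong_open K"
  then show "strong_open (\<Union>\<K>)"
    unfolding strong_open_def by (meson Union_iff Union_upper subset_trans)
qed

lemma openin_strong_topology: "openin strong_topology = strong_open"
  unfolding strong_topology_def by (simp add: istopology_strong_open)

text \<open>Addition on \<^typ>\<open>ereal\<close> satisfies \<^prop>\<open>(\<infinity>::ereal) + - \<infinity> = \<infinity>\<close> and
  \<^prop>\<open>- (\<infinity>::ereal) + \<infinity> = \<infinity>\<close>, which is the convention used in convex analysis.\<close>

definition effdom :: "('a \<Rightarrow> ereal) \<Rightarrow> 'a set" where
  "effdom h = {x. h x < \<infinity>}"

definition epi :: "('a \<Rightarrow> ereal) \<Rightarrow> ('a \<times> real) set" where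
  "epi h = {(x, r). h x \<le> ereal r}"

definition convex_fun :: "('a::real_vector \<Rightarrow> ereal) \<Rightarrow> bool" where
  "convex_fun h \<longleftrightarrow> convex (epi h)"

definition closure_fun :: "('a::topological_space \<Rightarrow> ereal) \<Rightarrow> 'a \<Rightarrow> ereal" where
  "closure_fun h = (THE g. epi g = closure (epi h))"

lemma epi_inject: "epi g = epi h \<Longrightarrow> g = h"
proof
  fix x
  assume *: "epi g = epi h"
  have "g x \<le> ereal r \<longleftrightarrow> h x \<le> ereal r" for r
    using * unfolding epi_def set_eq_iff by auto
  then show "g x = h x"
    by (metis antisym ereal_le_real)
qed

lemma ex1_closure_fun:
  fixes h :: "'a::topological_space \<Rightarrow> ereal"
  shows "\<exists>!g. epi g = closure (epi h)"
proof (rule ex_ex1I)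
  let ?C = "closure (epi h)"
  define g where "g x = Inf {ereal r | r. (x, r) \<in> ?C}" for x
  have up: "(x, s) \<in> ?C" if "(x, r) \<in> ?C" "r \<le> s" for x r s
  proof -
    let ?\<tau> = "\<lambda>p::'a \<times> real. (fst p, snd p + (s - r))"
    have "h y \<le> ereal (q + (s - r))" if "h y \<le> ereal q" for y q
      by (rule order_trans[OF that]) (use \<open>r \<le> s\<close> in simp)
    then have "?\<tau> ` epi h \<subseteq> ?C"
      using closure_subset[of "epi h"] by (fastforce simp: epi_def)
    moreover have "continuous_on ?C ?\<tau>"
      by (intro continuous_intros)
    ultimately have "?\<tau> ` ?C \<subseteq> ?C"
      by (intro image_closure_subset) auto
    then show ?thesis
      using that(1) by force
  qed
  have "(x, r) \<in> ?C" if "g x \<le> ereal r" for x r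
  proof -
    have above: "(x, s) \<in> ?C" if "r < s" for s
    proof -
      have "g x < ereal s"
        by (rule le_less_trans[OF \<open>g x \<le> ereal r\<close>]) (simp add: \<open>r < s\<close>)
      then obtain q where "(x, q) \<in> ?C" "q < s"
        unfolding g_def Inf_less_iff by auto
      then show ?thesis
        using up by simp
    qed
    have "(\<lambda>n. (x, r + inverse (real (Suc n)))) \<longlonglongrightarrow> (x, r + 0)"
      by (intro tendsto_intros LIMSEQ_inverse_real_of_nat)
    then show ?thesis
      using closed_sequentially[of ?C "\<lambda>n. (x, r + inverse (real (Suc n)))"] above
      by simp
  qed
  moreover have "g x \<le> ereal r" if "(x, r) \<in> ?C" for x r
    unfolding g_def by (rule Inf_lower) (use that in auto)
  ultimately show "\<exists>g. epi g = ?C"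
    by (intro exI[of _ g]) (auto simp: epi_def)
next
  fix g g' :: "'a \<Rightarrow> ereal"
  assume "epi g = closure (epi h)" "epi g' = closure (epi h)"
  then show "g = g'"
    by (intro epi_inject[of g g']) simp
qed

lemma epi_closure_fun: "epi (closure_fun h) = closure (epi h)"
  unfolding closure_fun_def by (rule theI'[OF ex1_closure_fun])

definition indicator_fun :: "'a set \<Rightarrow> 'a \<Rightarrow> ereal" where
  "indicator_fun A x = (if x \<in> A then 0 else \<infinity>)"

definition eps_subdiff ::
    "real \<Rightarrow> ('a::locally_convex_space \<Rightarrow> ereal) \<Rightarrow> 'a \<Rightarrow> 'a dual set" where
  "eps_subdiff \<epsilon> h x =
     (if \<bar>h x\<bar> \<noteq> \<infinity>
      then {\<phi>. \<forall>y. h y \<ge> h x + ereal (dual_apply \<phi> (y - x)) - ereal \<epsilon>}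
      else {})"

definition subdiff :: "('a::locally_convex_space \<Rightarrow> ereal) \<Rightarrow> 'a \<Rightarrow> 'a dual set" where
  "subdiff h x = eps_subdiff 0 h x"

definition normal_cone :: "'a::locally_convex_space set \<Rightarrow> 'a \<Rightarrow> 'a dual set" where
  "normal_cone A x = (if x \<in> A then {\<phi>. \<forall>z\<in>A. dual_apply \<phi> (z - x) \<le> 0} else {})"

definition fin_dim_subspaces :: "'a::real_vector \<Rightarrow> 'a set set" where
  "fin_dim_subspaces x = {L. subspace L \<and> (\<exists>B. finite B \<and> span B = L) \<and> x \<in> L}"

definition active_indices ::
    "'i set \<Rightarrow> ('i \<Rightarrow> 'a \<Rightarrow> ereal) \<Rightarrow> ('a \<Rightarrow> ereal) \<Rightarrow> real \<Rightarrow> 'a \<Rightarrow> 'i set" where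
  "active_indices T ft f \<epsilon> x = {t \<in> T. ft t x \<ge> f x - ereal \<epsilon>}"

end

theory Submission
  imports Defs
begin

text \<open>Fix a finite-dimensional \<open>L\<close> and put \<open>D = L \<inter> dom f\<close>, \<open>S = D - x\<close>. On either side the sets
  \<open>A \<epsilon>\<close> whose closures are taken are stable under adding the polar cone of \<open>S\<close>, which contains the
  annihilator of \<open>span S\<close>; hence closures are decided on a finite basis \<open>B \<subseteq> S\<close> of \<open>span S\<close>, and strong
  and weak-star closure play the same role. If \<open>\<phi> \<in> \<partial>f(x)\<close> were separated from \<open>co (A \<epsilon>)\<close>, the
  separating vector would lie in the closed cone generated by \<open>S\<close>, and after a small perturbation
  in its relative interior. But for such \<open>v\<close> and small \<open>s\<close>, approximate subgradients at \<open>x + s v\<close> of a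
  function nearly attaining the supremum there belong to \<open>A \<epsilon>\<close> and exceed \<open>\<phi>(v) - \<beta>\<close> on \<open>v\<close>. So \<open>\<phi>\<close>
  is approximated by \<open>co (A \<epsilon>)\<close> for every \<open>\<epsilon>\<close>. Caratheodory's theorem and compactness then give a
  convex combination of limits: the terms \<open>\<lambda>\<^sub>i \<psi>\<^sub>i\<close> are bounded on \<open>S\<close>, since each is bounded above
  there and their sum converges, and those with \<open>\<lambda>\<^sub>i \<rightarrow> 0\<close> tend to elements of the polar cone, which
  the remaining terms absorb.\<close>

subsection \<open>Hahn--Banach theorem and separation in real vector spaces\<close>

text \<open>No lower semicontinuity is assumed, so a convex function may have no affine minorant
  that is nearly exact at a given point of its domain. In the first formula, restriction to
  \<open>L \<inter> effdom f\<close> makes the domain finite-dimensional, and there a convex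
  function agrees with its closure at relative interior points; this is why the separating vector
  must be moved into the relative interior. In the second formula the functions are not restricted,
  and the assumption on closures supplies the affine minorants. The evaluation point is moved from
  \<open>x\<close> to \<open>x + s v\<close> because a function active at \<open>x\<close> need not
  reflect the growth of \<open>f\<close> towards \<open>v\<close>. A function nearly attaining the
  supremum at \<open>x + s v\<close> does reflect it, and an upper bound on its slope, uniform in
  \<open>s\<close>, makes the loss at \<open>x\<close> small with \<open>s\<close>. The convex hull
  stands outside the intersection over \<epsilon>. Hence the convex combinations found for different
  \<epsilon> must have the same number of terms, which a finite basis guarantees.\<close>

definition sublinear :: "('a::real_vector \<Rightarrow> real) \<Rightarrow> bool" where
  "sublinear p \<longleftrightarrow> (\<forall>x y. p (x + y) \<le> p x + p y) \<and> (\<forall>c\<ge>0. \<forall>x. p (c *\<^sub>R x) = c * p x)"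

lemma sublinear_add: "sublinear p \<Longrightarrow> p (x + y) \<le> p x + p y"
  and sublinear_scaleR: "sublinear p \<Longrightarrow> c \<ge> 0 \<Longrightarrow> p (c *\<^sub>R x) = c * p x"
  by (auto simp: sublinear_def)

lemma sublinear_zero: "sublinear p \<Longrightarrow> p 0 = 0"
  using sublinear_scaleR[of p 0 0] by simp

lemma sublinear_minus: "sublinear p \<Longrightarrow> - p (- x) \<le> p x"
  using sublinear_add[of p x "- x"] sublinear_zero[of p] by simp

text \<open>The bound \<open>q x \<ge> - q (- x) \<ge> - p (- x)\<close> keeps the pointwise infimum
  finite, and for subadditivity two members of the chain are replaced by the smaller one. This
  supplies the bounds for chains in Zorn's lemma.\<close>

lemma sublinear_INF_chain:
  fixes p :: "'a::real_vector \<Rightarrow> real"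
  assumes "C \<noteq> {}" and sub: "\<And>q. q \<in> C \<Longrightarrow> sublinear q" and le: "\<And>q. q \<in> C \<Longrightarrow> q \<le> p"
    and chain: "\<And>q r. q \<in> C \<Longrightarrow> r \<in> C \<Longrightarrow> q \<le> r \<or> r \<le> q"
  shows "sublinear (\<lambda>x. INF q\<in>C. q x)" and "q \<in> C \<Longrightarrow> (INF r\<in>C. r x) \<le> q x"
proof -
  have bdd: "bdd_below ((\<lambda>q. q x) ` C)" for x
  proof (rule bdd_belowI2)
    fix q assume "q \<in> C"
    then show "- p (- x) \<le> q x"
      using sublinear_minus[OF sub, of q x] le_funD[OF le, of q "- x"] by linarith
  qed
  have low: "(INF r\<in>C. r x) \<le> q x" if "q \<in> C" for q x
    by (rule cINF_lower[OF bdd that])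
  show "q \<in> C \<Longrightarrow> (INF r\<in>C. r x) \<le> q x" by (rule low)
  show "sublinear (\<lambda>x. INF q\<in>C. q x)"
    unfolding sublinear_def
  proof (intro conjI allI impI)
    fix x y
    have *: "(INF q\<in>C. q (x + y)) \<le> q x + r y" if qr: "q \<in> C" "r \<in> C" for q r
    proof -
      obtain s where "s \<in> C" "s \<le> q" "s \<le> r"
        using chain[OF qr] \<open>q \<in> C\<close> \<open>r \<in> C\<close> by blast
      then have "s x \<le> q x" "s y \<le> r y" by (auto simp: le_fun_def)
      then show ?thesis
        using low[OF \<open>s \<in> C\<close>, of "x + y"] sublinear_add[OF sub[OF \<open>s \<in> C\<close>], of x y] by linarith
    qed
    have "(INF q\<in>C. q (x + y)) - r y \<le> (INF q\<in>C. q x)" if "r \<in> C" for r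
      by (rule cINF_greatest[OF \<open>C \<noteq> {}\<close>]) (use *[OF _ that] in \<open>auto simp: algebra_simps\<close>)
    then have "(INF q\<in>C. q (x + y)) - (INF q\<in>C. q x) \<le> (INF r\<in>C. r y)"
      by (intro cINF_greatest[OF \<open>C \<noteq> {}\<close>]) (auto simp: algebra_simps)
    then show "(INF q\<in>C. q (x + y)) \<le> (INF q\<in>C. q x) + (INF q\<in>C. q y)" by simp
  next
    have half: "c * (INF q\<in>C. q x) \<le> (INF q\<in>C. q (c *\<^sub>R x))" if "c \<ge> 0" for c :: real and x
      by (rule cINF_greatest[OF \<open>C \<noteq> {}\<close>])
        (use low that in \<open>auto simp: sublinear_scaleR[OF sub] intro: mult_left_mono\<close>)
    fix c :: real and x :: 'a assume "c \<ge> 0"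
    show "(INF q\<in>C. q (c *\<^sub>R x)) = c * (INF q\<in>C. q x)"
    proof (cases "c = 0")
      case True
      have "(INF q\<in>C. q 0) = (INF q\<in>C. 0)"
        by (rule INF_cong) (auto simp: sublinear_zero sub)
      then show ?thesis using True \<open>C \<noteq> {}\<close> by simp
    next
      case False
      then have "c > 0" using \<open>c \<ge> 0\<close> by simp
      have "inverse c * (INF q\<in>C. q (c *\<^sub>R x)) \<le> (INF q\<in>C. q x)"
        using half[of "inverse c" "c *\<^sub>R x"] \<open>c > 0\<close> by simp
      then have "(INF q\<in>C. q (c *\<^sub>R x)) \<le> c * (INF q\<in>C. q x)"
        using \<open>c > 0\<close> by (simp add: field_simps)
      then show ?thesis using half[of c x] \<open>c \<ge> 0\<close> by simp
    qed
  qed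
qed

text \<open>\<open>r\<close> is \<open>q\<close> made linear along \<open>a\<close>: every sublinear
  \<open>s\<close> below \<open>q\<close> with \<open>s (- a) \<le> - q a\<close> satisfies \<open>s
  x \<le> s (x + t *\<^sub>R a) + t * s (- a) \<le> q (x + t *\<^sub>R a) - t * q a\<close>, so
  \<open>r\<close> is the largest such functional.\<close>

lemma sublinear_INF_ray:
  fixes q :: "'a::real_vector \<Rightarrow> real" and a :: 'a
  assumes q: "sublinear q"
  defines "r \<equiv> \<lambda>x. INF t\<in>{0..}. q (x + t *\<^sub>R a) - t * q a"
  shows "sublinear r" and "r x \<le> q x" and "r (- a) \<le> - q a"
proof -
  have bdd: "bdd_below ((\<lambda>t. q (x + t *\<^sub>R a) - t * q a) ` {0..})" for x
  proof (rule bdd_belowI2)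
    fix t :: real assume "t \<in> {0..}"
    then show "- q (- x) \<le> q (x + t *\<^sub>R a) - t * q a"
      using sublinear_add[OF q, of "x + t *\<^sub>R a" "- x"] sublinear_scaleR[OF q, of t a] by simp
  qed
  have low: "r x \<le> q (x + t *\<^sub>R a) - t * q a" if "t \<ge> 0" for x t
    unfolding r_def by (rule cINF_lower[OF bdd]) (use that in simp)
  have great: "m \<le> r x" if "\<And>t. t \<ge> 0 \<Longrightarrow> m \<le> q (x + t *\<^sub>R a) - t * q a" for m x
    unfolding r_def by (rule cINF_greatest) (use that in auto)
  show "r x \<le> q x" for x using low[of 0 x] by simp
  show "r (- a) \<le> - q a" using low[of 1 "- a"] by (simp add: sublinear_zero[OF q])
  have half: "c * r x \<le> r (c *\<^sub>R x)" if "c > 0" for c x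
  proof (rule great)
    fix t :: real assume "t \<ge> 0"
    then have "r x \<le> q (x + (t / c) *\<^sub>R a) - (t / c) * q a" using \<open>c > 0\<close> by (intro low) simp
    then have "c * r x \<le> c * q (x + (t / c) *\<^sub>R a) - t * q a"
      using \<open>c > 0\<close> by (simp add: field_simps)
    also have "c * q (x + (t / c) *\<^sub>R a) = q (c *\<^sub>R x + t *\<^sub>R a)"
      using sublinear_scaleR[OF q, of c "x + (t / c) *\<^sub>R a"] \<open>c > 0\<close> by (simp add: scaleR_add_right)
    finally show "c * r x \<le> q (c *\<^sub>R x + t *\<^sub>R a) - t * q a" .
  qed
  have r0: "r 0 = 0"
  proof (rule antisym)
    show "r 0 \<le> 0" using low[of 0 0] by (simp add: sublinear_zero[OF q])
    show "0 \<le> r 0" by (rule great) (simp add: sublinear_scaleR[OF q])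
  qed
  show "sublinear r"
    unfolding sublinear_def
  proof (intro conjI allI impI)
    fix x y
    have *: "r (x + y) \<le> (q (x + t *\<^sub>R a) - t * q a) + (q (y + s *\<^sub>R a) - s * q a)"
      if "t \<ge> 0" "s \<ge> 0" for t s
      using low[of "t + s" "x + y"] that sublinear_add[OF q, of "x + t *\<^sub>R a" "y + s *\<^sub>R a"]
      by (simp add: algebra_simps)
    have "r (x + y) - (q (y + s *\<^sub>R a) - s * q a) \<le> r x" if "s \<ge> 0" for s
      by (rule great) (use *[OF _ that] in \<open>fastforce simp: algebra_simps\<close>)
    then have "r (x + y) - r x \<le> r y"
      by (intro great) (fastforce simp: algebra_simps)
    then show "r (x + y) \<le> r x + r y" by simp
  next
    fix c :: real and x assume "c \<ge> 0"
    show "r (c *\<^sub>R x) = c * r x"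
    proof (cases "c = 0")
      case False
      then have "c > 0" using \<open>c \<ge> 0\<close> by simp
      have "inverse c * r (c *\<^sub>R x) \<le> r x" using half[of "inverse c" "c *\<^sub>R x"] \<open>c > 0\<close> by simp
      then show ?thesis using half[OF \<open>c > 0\<close>, of x] \<open>c > 0\<close> by (simp add: field_simps)
    qed (simp add: r0)
  qed
qed

text \<open>A minimal sublinear functional below \<open>p\<close> is linear: the infimum along a ray can only lower it.\<close>

lemma Hahn_Banach_sublinear:
  fixes p :: "'a::real_vector \<Rightarrow> real"
  assumes p: "sublinear p"
  obtains \<psi> where "linear \<psi>" "\<And>x. \<psi> x \<le> p x" "\<psi> a = p a"
proof -
  \<comment> \<open>Minimizing below \<open>p'\<close> instead of \<open>p\<close> forces
    \<open>\<psi> (- a) \<le> - p a\<close>, hence equality at \<open>a\<close> once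
    \<open>\<psi>\<close> is linear.\<close>
  define p' where "p' x = (INF t\<in>{0..}. p (x + t *\<^sub>R a) - t * p a)" for x
  note p' = sublinear_INF_ray[OF p, where a = a, folded p'_def]
  define A where "A = {q. sublinear q \<and> q \<le> p'}"
  \<comment> \<open>The order is reversed, so the maximal element given by Zorn's lemma is a minimal
    functional.\<close>
  let ?P = "\<lambda>q r :: 'a \<Rightarrow> real. r \<le> q"
  have "\<exists>m\<in>A. \<forall>q\<in>A. ?P m q \<longrightarrow> q = m"
  proof (rule predicate_Zorn)
    show "partial_order_on A (relation_of ?P A)"
      by (auto simp: partial_order_on_def preorder_on_def refl_on_def trans_def antisym_def relation_of_def)
  next
    fix C assume C: "C \<in> Chains (relation_of ?P A)"
    then have CA: "q \<in> A" if "q \<in> C" for q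
      using that unfolding Chains_def relation_of_def by auto
    show "\<exists>u\<in>A. \<forall>q\<in>C. ?P q u"
    proof (cases "C = {}")
      case True
      then show ?thesis using p'(1) by (auto simp: A_def)
    next
      case False
      have ch: "q \<le> r \<or> r \<le> q" if "q \<in> C" "r \<in> C" for q r
        using C that unfolding Chains_def relation_of_def by auto
      have sub: "sublinear q" "q \<le> p'" if "q \<in> C" for q using CA[OF that] by (auto simp: A_def)
      note I = sublinear_INF_chain[OF False sub ch]
      obtain q where "q \<in> C" using False by blast
      have "(\<lambda>x. INF r\<in>C. r x) \<le> q" using I(2)[OF _ _ _ _ \<open>q \<in> C\<close>] by (auto simp: le_fun_def)
      then have "(\<lambda>x. INF r\<in>C. r x) \<le> p'" using sub(2)[OF \<open>q \<in> C\<close>] by (rule order_trans)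
      then show ?thesis using I by (intro bexI[of _ "\<lambda>x. INF r\<in>C. r x"]) (auto simp: A_def le_fun_def)
    qed
  qed
  then obtain \<psi> where \<psi>: "sublinear \<psi>" "\<psi> \<le> p'" and min: "\<And>q. sublinear q \<Longrightarrow> q \<le> p' \<Longrightarrow> q \<le> \<psi> \<Longrightarrow> q = \<psi>"
    by (auto simp: A_def)
  have neg: "\<psi> (- x) = - \<psi> x" for x
  proof (rule antisym)
    let ?q = "\<lambda>y. INF t\<in>{0..}. \<psi> (y + t *\<^sub>R x) - t * \<psi> x"
    note q = sublinear_INF_ray[OF \<psi>(1), where a = x]
    have le: "?q \<le> \<psi>" unfolding le_fun_def by (intro allI q(2))
    have "?q = \<psi>" by (rule min[OF q(1) order_trans[OF le \<psi>(2)] le])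
    from fun_cong[OF this, of "- x"] q(3) show "\<psi> (- x) \<le> - \<psi> x" by simp
    show "- \<psi> x \<le> \<psi> (- x)" using sublinear_minus[OF \<psi>(1), of "- x"] by simp
  qed
  have "linear \<psi>"
  proof (rule linearI)
    fix x y
    show "\<psi> (x + y) = \<psi> x + \<psi> y"
      using sublinear_add[OF \<psi>(1), of x y] sublinear_add[OF \<psi>(1), of "x + y" "- y"] neg[of y] by simp
  next
    fix c :: real and x
    show "\<psi> (c *\<^sub>R x) = c *\<^sub>R \<psi> x"
    proof (cases "c \<ge> 0")
      case False
      then show ?thesis using sublinear_scaleR[OF \<psi>(1), of "- c" x] neg[of "c *\<^sub>R x"] by simp
    qed (simp add: sublinear_scaleR[OF \<psi>(1)])
  qed
  moreover have "\<psi> x \<le> p x" for x using le_funD[OF \<psi>(2), of x] p'(2)[of x] by linarith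
  moreover have "\<psi> a = p a"
  proof (rule antisym)
    have "\<psi> (- a) \<le> - p a" using le_funD[OF \<psi>(2), of "- a"] p'(3) by linarith
    then show "p a \<le> \<psi> a" using neg[of a] by simp
  qed fact
  ultimately show thesis by (rule that)
qed

text \<open>\<open>\<psi>\<close> is a Hahn--Banach minorant of the Minkowski gauge \<open>g\<close>
  of \<open>K\<close>, exact at \<open>p\<close>. Absorption makes the gauge finite, and
  \<open>p \<notin> K\<close> makes it at least 1 at \<open>p\<close>.\<close>

lemma absorbing_convex_separation:
  fixes K :: "'a::real_vector set"
  assumes "convex K" and "0 \<in> K" and absorb: "\<And>x. \<exists>r>0. r *\<^sub>R x \<in> K" and "p \<notin> K"
  obtains \<psi> :: "'a \<Rightarrow> real" where "linear \<psi>" "\<psi> p \<ge> 1" "\<And>x. x \<in> K \<Longrightarrow> \<psi> x \<le> 1"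
proof -
  define G where "G x = {r. r > 0 \<and> (1 / r) *\<^sub>R x \<in> K}" for x
  define g where "g x = Inf (G x)" for x
  have ne: "G x \<noteq> {}" for x
  proof -
    obtain r where "r > 0" "r *\<^sub>R x \<in> K" using absorb by blast
    then have "1 / r \<in> G x" by (simp add: G_def)
    then show ?thesis by blast
  qed
  have low: "g x \<le> r" if "r \<in> G x" for r x
    unfolding g_def by (rule cInf_lower[OF that]) (auto simp: G_def intro!: bdd_belowI[of _ 0] less_imp_le)
  have great: "m \<le> g x" if "\<And>r. r \<in> G x \<Longrightarrow> m \<le> r" for m x
    unfolding g_def by (rule cInf_greatest[OF ne]) (use that in auto)
  have Gadd: "r + s \<in> G (x + y)" if "r \<in> G x" "s \<in> G y" for r s x y
  proof -
    have rs: "r > 0" "s > 0" using that by (auto simp: G_def)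
    then have "(r / (r + s)) *\<^sub>R ((1 / r) *\<^sub>R x) + (s / (r + s)) *\<^sub>R ((1 / s) *\<^sub>R y) \<in> K"
      using that by (intro convexD[OF \<open>convex K\<close>]) (auto simp: G_def simp flip: add_divide_distrib)
    then show ?thesis using rs by (simp add: G_def scaleR_add_right)
  qed
  have half: "c * g x \<le> g (c *\<^sub>R x)" if "c > 0" for c x
  proof (rule great)
    fix r assume "r \<in> G (c *\<^sub>R x)"
    then have "r / c \<in> G x" using that by (simp add: G_def)
    then show "c * g x \<le> r" using low[of "r / c" x] that by (simp add: field_simps)
  qed
  have g0: "g 0 = 0"
  proof (rule antisym)
    show "g 0 \<le> 0"
      by (rule field_le_epsilon) (use low[of _ 0] \<open>0 \<in> K\<close> in \<open>auto simp: G_def\<close>)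
    show "0 \<le> g 0" by (rule great) (simp add: G_def)
  qed
  have "sublinear g"
    unfolding sublinear_def
  proof (intro conjI allI impI)
    fix x y
    have "g (x + y) - s \<le> g x" if "s \<in> G y" for s
      by (rule great) (use low[OF Gadd[OF _ that]] in \<open>force simp: algebra_simps\<close>)
    then have "g (x + y) - g x \<le> g y" by (intro great) (force simp: algebra_simps)
    then show "g (x + y) \<le> g x + g y" by simp
  next
    fix c :: real and x assume "c \<ge> 0"
    show "g (c *\<^sub>R x) = c * g x"
    proof (cases "c = 0")
      case False
      then have "c > 0" using \<open>c \<ge> 0\<close> by simp
      have "inverse c * g (c *\<^sub>R x) \<le> g x" using half[of "inverse c" "c *\<^sub>R x"] \<open>c > 0\<close> by simp
      then show ?thesis using half[OF \<open>c > 0\<close>, of x] \<open>c > 0\<close> by (simp add: field_simps)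
    qed (simp add: g0)
  qed
  then obtain \<psi> where \<psi>: "linear \<psi>" "\<And>x. \<psi> x \<le> g x" "\<psi> p = g p"
    by (rule Hahn_Banach_sublinear[where a = p]) blast
  have "1 \<le> g p"
  proof (rule great, rule ccontr)
    fix r assume r: "r \<in> G p" "\<not> 1 \<le> r"
    then have "r *\<^sub>R ((1 / r) *\<^sub>R p) + (1 - r) *\<^sub>R 0 \<in> K"
      by (intro convexD[OF \<open>convex K\<close>]) (auto simp: G_def \<open>0 \<in> K\<close>)
    then show False using r \<open>p \<notin> K\<close> by (simp add: G_def)
  qed
  moreover have "\<psi> x \<le> 1" if "x \<in> K" for x
    using \<psi>(2)[of x] low[of 1 x] that by (simp add: G_def)
  ultimately show thesis using that[of \<psi>] \<psi> by simp
qed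

text \<open>The point \<open>p - c0\<close> is separated from the absorbing set
  \<open>C - c0 + W\<close>. The formulation is purely algebraic because it serves twice: in the
  space with an open \<open>W\<close>, where \<open>\<psi> \<le> 1\<close> on \<open>W\<close>
  yields continuity, and in the dual with a \<open>W\<close> given by finitely many
  evaluations.\<close>

lemma absorbing_strict_separation:
  fixes C W :: "'a::real_vector set"
  assumes "convex C" "C \<noteq> {}" and "convex W" "0 \<in> W" and absorb: "\<And>x. \<exists>r>0. r *\<^sub>R x \<in> W"
    and disj: "\<And>w. w \<in> W \<Longrightarrow> p - w \<notin> C"
  obtains \<psi> :: "'a \<Rightarrow> real" and \<eta>
  where "linear \<psi>" "\<And>w. w \<in> W \<Longrightarrow> \<psi> w \<le> 1" "\<eta> > 0" "\<And>c. c \<in> C \<Longrightarrow> \<psi> c + \<eta> \<le> \<psi> p"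
proof -
  obtain c0 where "c0 \<in> C" using assms(2) by blast
  define K where "K = {c - c0 + w | c w. c \<in> C \<and> w \<in> W}"
  have K: "c - c0 + w \<in> K" if "c \<in> C" "w \<in> W" for c w using that by (auto simp: K_def)
  have WK: "w \<in> K" if "w \<in> W" for w using K[OF \<open>c0 \<in> C\<close> that] by simp
  have "convex K"
  proof (rule convexI)
    fix x y and u v :: real
    assume "x \<in> K" "y \<in> K" and uv: "u \<ge> 0" "v \<ge> 0" "u + v = 1"
    then obtain c d a b where *: "c \<in> C" "a \<in> W" "x = c - c0 + a" "d \<in> C" "b \<in> W" "y = d - c0 + b"
      by (auto simp: K_def)
    have "u *\<^sub>R x + v *\<^sub>R y = (u *\<^sub>R c + v *\<^sub>R d) - (u + v) *\<^sub>R c0 + (u *\<^sub>R a + v *\<^sub>R b)"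
      unfolding *(3,6) by (simp add: algebra_simps)
    then show "u *\<^sub>R x + v *\<^sub>R y \<in> K"
      using K[OF convexD[OF assms(1) *(1,4) uv] convexD[OF assms(3) *(2,5) uv]] uv by simp
  qed
  moreover have "0 \<in> K" using WK \<open>0 \<in> W\<close> by blast
  moreover have "\<exists>r>0. r *\<^sub>R x \<in> K" for x using absorb WK by blast
  moreover have "p - c0 \<notin> K"
  proof
    assume "p - c0 \<in> K"
    then obtain c w where "c \<in> C" "w \<in> W" "p - w = c" by (auto simp: K_def algebra_simps)
    then show False using disj by blast
  qed
  ultimately obtain \<psi> :: "'a \<Rightarrow> real"
    where \<psi>: "linear \<psi>" "\<psi> (p - c0) \<ge> 1" "\<And>x. x \<in> K \<Longrightarrow> \<psi> x \<le> 1"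
    using absorbing_convex_separation[of K "p - c0"] by metis
  \<comment> \<open>This \<open>r\<close> becomes the gap:
    \<open>c - c0 + r *\<^sub>R (p - c0)\<close> lies in \<open>K\<close>, where
    \<open>\<psi> \<le> 1 \<le> \<psi> (p - c0)\<close>.\<close>
  obtain r where r: "r > 0" "r *\<^sub>R (p - c0) \<in> W" using absorb by blast
  have "\<psi> c + r \<le> \<psi> p" if "c \<in> C" for c
  proof -
    have "\<psi> (c - c0 + r *\<^sub>R (p - c0)) \<le> 1" using \<psi>(3) K[OF that r(2)] by blast
    then have "\<psi> c - \<psi> c0 + r * \<psi> (p - c0) \<le> 1"
      by (simp add: linear_add[OF \<psi>(1)] linear_diff[OF \<psi>(1)] linear_cmul[OF \<psi>(1)])
    moreover have "r * 1 \<le> r * \<psi> (p - c0)" using r \<psi>(2) by (intro mult_left_mono) auto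
    moreover have "\<psi> (p - c0) = \<psi> p - \<psi> c0" by (rule linear_diff[OF \<psi>(1)])
    ultimately show ?thesis using \<psi>(2) by linarith
  qed
  then show thesis using that[of \<psi> r] \<psi>(1,3) WK r(1) by blast
qed

subsection \<open>Separation in locally convex spaces\<close>

lemma tendsto_scaleR_lcs:
  fixes g :: "'b \<Rightarrow> 'a::locally_convex_space"
  assumes "(f \<longlongrightarrow> r) F" "(g \<longlongrightarrow> a) F"
  shows "((\<lambda>x. f x *\<^sub>R g x) \<longlongrightarrow> r *\<^sub>R a) F"
  using filterlim_compose[OF tendsto_scaleR_Pair filterlim_Pair[OF assms]] by simp

lemma continuous_on_scaleR_lcs:
  fixes g :: "'b::topological_space \<Rightarrow> 'a::locally_convex_space"
  assumes "continuous_on S f" "continuous_on S g"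
  shows "continuous_on S (\<lambda>x. f x *\<^sub>R g x)"
  using assms unfolding continuous_on_def by (auto intro: tendsto_scaleR_lcs)

section \<open>Locally convex structure on products, where epigraphs are separated from
  points\<close>

instance prod :: (topological_monoid_add, topological_monoid_add) topological_monoid_add
proof
  fix a b :: "'a \<times> 'b"
  have "((\<lambda>x. (fst (fst x) + fst (snd x), snd (fst x) + snd (snd x)))
      \<longlongrightarrow> (fst a + fst b, snd a + snd b)) (nhds a \<times>\<^sub>F nhds b)"
    by (intro tendsto_Pair tendsto_add tendsto_fst tendsto_snd filterlim_fst filterlim_snd)
  then show "LIM x (nhds a \<times>\<^sub>F nhds b). fst x + snd x :> nhds (a + b)"
    by (simp add: plus_prod_def)
qed

instance prod :: (topological_group_add, topological_group_add) topological_group_add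
proof
  fix a :: "'a \<times> 'b"
  have "((\<lambda>x. (- fst x, - snd x)) \<longlongrightarrow> (- fst a, - snd a)) (nhds a)"
    by (intro tendsto_Pair tendsto_minus tendsto_fst tendsto_snd filterlim_ident)
  then show "(uminus \<longlongrightarrow> - a) (nhds a)"
    by (simp add: uminus_prod_def[abs_def])
qed

instance prod :: (topological_ab_group_add, topological_ab_group_add) topological_ab_group_add ..

instance prod :: (locally_convex_space, locally_convex_space) locally_convex_space
proof
  fix r :: real and a :: "'a \<times> 'b"
  have "((\<lambda>p. (fst p *\<^sub>R fst (snd p), fst p *\<^sub>R snd (snd p)))
      \<longlongrightarrow> (r *\<^sub>R fst a, r *\<^sub>R snd a)) (nhds r \<times>\<^sub>F nhds a)"
    by (intro tendsto_Pair tendsto_scaleR_lcs tendsto_fst tendsto_snd filterlim_fst filterlim_snd)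
  then show "LIM p (nhds r \<times>\<^sub>F nhds a). fst p *\<^sub>R snd p :> nhds (r *\<^sub>R a)"
    by (simp add: scaleR_prod_def)
next
  fix U :: "('a \<times> 'b) set" assume U: "open U" "0 \<in> U"
  then obtain A B where AB: "open A" "open B" "0 \<in> A" "0 \<in> B" "A \<times> B \<subseteq> U"
    unfolding zero_prod_def by (elim open_prod_elim) auto
  obtain A' where A': "open A'" "convex A'" "0 \<in> A'" "A' \<subseteq> A"
    using convex_open_base[OF AB(1,3)] by blast
  obtain B' where B': "open B'" "convex B'" "0 \<in> B'" "B' \<subseteq> B"
    using convex_open_base[OF AB(2,4)] by blast
  have "convex (A' \<times> B')" by (intro convex_Times A' B')
  then show "\<exists>V. open V \<and> 0 \<in> V \<and> V \<subseteq> U \<and>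
      (\<forall>x\<in>V. \<forall>y\<in>V. \<forall>u\<ge>0. \<forall>v\<ge>0. u + v = 1 \<longrightarrow> u *\<^sub>R x + v *\<^sub>R y \<in> V)"
    using A' B' AB unfolding convex_def
    by (intro exI[of _ "A' \<times> B'"] conjI open_Times) (auto simp: zero_prod_def)
qed

section \<open>Continuous functionals, strict separation and affine minorants\<close>

lemma linear_dual_apply: "linear (dual_apply \<phi>)"
  and continuous_on_dual_apply: "continuous_on UNIV (dual_apply \<phi>)"
  using dual_apply[of \<phi>] by auto

lemma dual_apply_Dual:
  "linear \<psi> \<Longrightarrow> continuous_on UNIV \<psi> \<Longrightarrow> dual_apply (Dual \<psi>) = \<psi>"
  by (rule Dual_inverse) simp

lemmas dual_apply_simps =
  zero_dual.rep_eq plus_dual.rep_eq minus_dual.rep_eq uminus_dual.rep_eq scaleR_dual.rep_eq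
  linear_0[OF linear_dual_apply] linear_add[OF linear_dual_apply]
  linear_diff[OF linear_dual_apply] linear_neg[OF linear_dual_apply]
  linear_cmul[OF linear_dual_apply, simplified]

lemma linear_evaluation: "linear (\<lambda>\<phi>. dual_apply \<phi> x)"
  by (rule linearI) (simp_all add: dual_apply_simps)

lemma dual_apply_sum:
  "dual_apply (\<Sum>i\<in>I. g i) x = (\<Sum>i\<in>I. dual_apply (g i) x)"
  using linear_sum[OF linear_evaluation[of x], of g I] by simp

text \<open>A one-sided bound suffices because the neighbourhood \<open>V\<close> of
  \<open>a\<close> requires multiples of both \<open>y - a\<close> and \<open>a - y\<close> to lie
  in \<open>U\<close>.\<close>

lemma linear_bounded_above_imp_continuous:
  fixes \<psi> :: "'a::locally_convex_space \<Rightarrow> real"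
  assumes \<psi>: "linear \<psi>" and U: "open U" "0 \<in> U" and le: "\<And>u. u \<in> U \<Longrightarrow> \<psi> u \<le> c"
  shows "continuous_on UNIV \<psi>"
  unfolding continuous_on_def
proof (intro ballI tendstoI)
  fix a and e :: real assume "e > 0"
  have "c \<ge> 0" using le[OF U(2)] linear_0[OF \<psi>] by simp
  \<comment> \<open>The summand 1 makes \<open>c < m * e\<close> strict and keeps \<open>m\<close>
    positive when \<open>c = 0\<close>.\<close>
  define m where "m = (c + 1) / e"
  have m: "m > 0" "c < m * e" using \<open>e > 0\<close> \<open>c \<ge> 0\<close> by (auto simp: m_def)
  define V where "V = (\<lambda>y. m *\<^sub>R (y - a)) -` U \<inter> (\<lambda>y. (- m) *\<^sub>R (y - a)) -` U"
  have "open V"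
    unfolding V_def
    by (intro open_Int open_vimage U continuous_on_scaleR_lcs continuous_intros)
  moreover have "a \<in> V" using U by (simp add: V_def)
  moreover have "dist (\<psi> y) (\<psi> a) < e" if "y \<in> V" for y
  proof -
    have "\<psi> (m *\<^sub>R (y - a)) \<le> c" "\<psi> ((- m) *\<^sub>R (y - a)) \<le> c"
      using that by (auto simp: V_def intro: le)
    then have "m * \<bar>\<psi> y - \<psi> a\<bar> \<le> c"
      using m(1) by (simp add: linear_cmul[OF \<psi>] linear_diff[OF \<psi>] linear_neg[OF \<psi>] abs_if algebra_simps)
    then have "m * \<bar>\<psi> y - \<psi> a\<bar> < m * e" using m by linarith
    then show ?thesis using m by (simp add: dist_real_def)
  qed
  ultimately show "\<forall>\<^sub>F y in at a within UNIV. dist (\<psi> y) (\<psi> a) < e"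
    unfolding eventually_at_topological by auto
qed

lemma open_absorbing:
  fixes V :: "'a::locally_convex_space set"
  assumes "open V" "0 \<in> V"
  shows "\<exists>r>0. r *\<^sub>R x \<in> V"
proof -
  have "((\<lambda>r. r *\<^sub>R x) \<longlongrightarrow> 0 *\<^sub>R x) (at_right 0)"
    by (intro tendsto_scaleR_lcs tendsto_const tendsto_ident_at)
  then have "\<forall>\<^sub>F r in at_right 0. r *\<^sub>R x \<in> V"
    using assms by (intro topological_tendstoD) auto
  then have "\<forall>\<^sub>F r in at_right (0::real). r *\<^sub>R x \<in> V \<and> r > 0"
    using eventually_at_right_less by (rule eventually_conj)
  then show ?thesis
    using eventually_happens'[OF trivial_limit_at_right_real] by blast
qed

lemma lcs_strict_separation:
  fixes C :: "'a::locally_convex_space set"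
  assumes "convex C" "C \<noteq> {}" "p \<notin> closure C"
  obtains \<psi> \<eta> where "\<eta> > 0" "\<And>c. c \<in> C \<Longrightarrow> dual_apply \<psi> c + \<eta> \<le> dual_apply \<psi> p"
proof -
  let ?W = "(\<lambda>u. p - u) -` (- closure C)"
  have "open ?W" by (intro open_vimage continuous_intros) auto
  moreover have "0 \<in> ?W" using assms(3) by simp
  ultimately obtain V where V: "open V" "convex V" "0 \<in> V" "V \<subseteq> ?W"
    using convex_open_base by blast
  then have "p - w \<notin> C" if "w \<in> V" for w using that closure_subset[of C] by auto
  then obtain \<psi> :: "'a \<Rightarrow> real" and \<eta> where \<psi>: "linear \<psi>" "\<And>w. w \<in> V \<Longrightarrow> \<psi> w \<le> 1"
    and \<eta>: "\<eta> > 0" "\<And>c. c \<in> C \<Longrightarrow> \<psi> c + \<eta> \<le> \<psi> p"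
    using absorbing_strict_separation[OF assms(1,2) V(2,3) open_absorbing[OF V(1,3)]] by metis
  have "continuous_on UNIV \<psi>"
    by (rule linear_bounded_above_imp_continuous[OF \<psi>(1) V(1,3) \<psi>(2)])
  then show thesis
    using that[of \<eta> "Dual \<psi>"] \<eta> by (simp add: dual_apply_Dual[OF \<psi>(1)])
qed

lemma ex_dual_nonzero:
  fixes a :: "'a::locally_convex_space"
  assumes "a \<noteq> 0"
  obtains \<psi> where "dual_apply \<psi> a \<noteq> 0"
proof -
  have "a \<notin> closure {0}" using assms by simp
  then obtain \<psi> \<eta> where "\<eta> > 0" "\<And>c. c \<in> {0} \<Longrightarrow> dual_apply \<psi> c + \<eta> \<le> dual_apply \<psi> a"
    by (rule lcs_strict_separation[rotated 2]) auto
  then show thesis using that[of \<psi>] by (simp add: dual_apply_simps)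
qed

text \<open>Strict separation of \<open>(z, r)\<close> from the epigraph gives a hyperplane that is
  not vertical, since the epigraph also has a point directly above \<open>(z, r)\<close>; this is
  where \<open>h z < \<infinity>\<close> enters. Dividing by its vertical coefficient
  \<open>\<kappa>\<close> turns the hyperplane into the graph of an affine minorant.\<close>

lemma affine_minorant_at:
  fixes h :: "'a::locally_convex_space \<Rightarrow> ereal"
  assumes "convex_fun h" and "h z < \<infinity>" and "(z, r) \<notin> closure (epi h)"
  obtains \<psi> where "\<And>y. ereal (r + dual_apply \<psi> (y - z)) \<le> h y"
proof -
  obtain q0 where "h z \<le> ereal q0"
    using \<open>h z < \<infinity>\<close> by (cases "h z") (auto intro: that[of 0])
  \<comment> \<open>The term \<open>r + 1\<close> places \<open>(z, q)\<close> strictly above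
    \<open>(z, r)\<close>, which yields \<open>\<kappa> > 0\<close>.\<close>
  define q where "q = max q0 (r + 1)"
  have q: "(z, q) \<in> epi h" "q > r"
    using \<open>h z \<le> ereal q0\<close> by (auto simp: epi_def q_def intro: order_trans)
  have "convex (epi h)" using assms(1) by (simp add: convex_fun_def)
  moreover have "epi h \<noteq> {}" using q(1) by blast
  ultimately obtain \<Psi> \<eta> where \<Psi>: "\<eta> > 0" "\<And>c. c \<in> epi h \<Longrightarrow> dual_apply \<Psi> c + \<eta> \<le> dual_apply \<Psi> (z, r)"
    using lcs_strict_separation[OF _ _ assms(3)] by blast
  define \<kappa> where "\<kappa> = - dual_apply \<Psi> (0, 1)"
  have split: "dual_apply \<Psi> (y, s) = dual_apply \<Psi> (y, 0) - \<kappa> * s" for y s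
  proof -
    have "(y, s) = (y, 0) + s *\<^sub>R (0, 1)" by simp
    then have "dual_apply \<Psi> (y, s) = dual_apply \<Psi> ((y, 0) + s *\<^sub>R (0, 1))" by simp
    then show ?thesis unfolding dual_apply_simps \<kappa>_def by simp
  qed
  have "\<kappa> * (r - q) < 0"
    using \<Psi>(2)[OF q(1)] \<Psi>(1) split[of z q] split[of z r] by (simp add: algebra_simps)
  then have "\<kappa> > 0" using q(2) by (simp add: mult_less_0_iff)
  define g where "g y = dual_apply \<Psi> (y, 0) / \<kappa>" for y
  have lin: "linear g"
  proof (rule linearI)
    fix x y show "g (x + y) = g x + g y"
      using linear_add[OF linear_dual_apply[of \<Psi>], of "(x, 0)" "(y, 0)"]
      by (simp add: g_def add_divide_distrib)
  next
    fix c :: real and x show "g (c *\<^sub>R x) = c *\<^sub>R g x"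
      using linear_cmul[OF linear_dual_apply[of \<Psi>], of c "(x, 0)"] by (simp add: g_def)
  qed
  have "continuous_on UNIV (\<lambda>y. dual_apply \<Psi> (y, 0))"
    by (rule continuous_on_compose2[OF continuous_on_dual_apply[of \<Psi>]]) (auto intro!: continuous_intros)
  then have cont: "continuous_on UNIV g"
    unfolding g_def divide_inverse by (intro continuous_on_mult_right)
  have "ereal (r + g (y - z)) \<le> h y" for y
  proof (rule ereal_le_real)
    fix s assume "h y \<le> ereal s"
    then have "(y, s) \<in> epi h" by (simp add: epi_def)
    from \<Psi>(2)[OF this] \<Psi>(1) split[of y s] split[of z r]
    have "dual_apply \<Psi> (y, 0) - dual_apply \<Psi> (z, 0) \<le> \<kappa> * (s - r)" by (simp add: algebra_simps)
    then have "g y - g z \<le> s - r"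
      using \<open>\<kappa> > 0\<close> by (simp add: g_def pos_divide_le_eq mult.commute flip: diff_divide_distrib)
    then show "ereal (r + g (y - z)) \<le> ereal s" by (simp add: linear_diff[OF lin])
  qed
  then show thesis using that[of "Dual g"] by (simp add: dual_apply_Dual[OF lin cont])
qed

subsection \<open>Finite-dimensional subspaces and closures in the dual\<close>

text \<open>A Gram--Schmidt step on the dual side: a functional not vanishing on the residual
  \<open>a'\<close> of \<open>a\<close> modulo \<open>span B\<close> is corrected to vanish on
  \<open>B\<close>, normalized at \<open>a\<close>, and then used to correct the old
  functionals.\<close>

lemma ex_biorthogonal:
  fixes B :: "'a::locally_convex_space set"
  assumes "finite B" "independent B"
  shows "\<exists>d. \<forall>b\<in>B. \<forall>c\<in>B. dual_apply (d b) c = (if b = c then 1 else 0)"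
  using assms
proof (induction B rule: finite_induct)
  case empty
  show ?case by simp
next
  case (insert a B)
  then have "independent B" "a \<notin> span B" by (auto simp: independent_insert)
  then obtain d where d: "\<And>b c. b \<in> B \<Longrightarrow> c \<in> B \<Longrightarrow> dual_apply (d b) c = (if b = c then 1 else 0)"
    using insert.IH by blast
  define a' where "a' = a - (\<Sum>b\<in>B. dual_apply (d b) a *\<^sub>R b)"
  have "(\<Sum>b\<in>B. dual_apply (d b) a *\<^sub>R b) \<in> span B"
    by (intro span_sum span_scale span_base)
  then have "a' \<noteq> 0" using \<open>a \<notin> span B\<close> by (auto simp: a'_def)
  then obtain \<psi> where \<psi>: "dual_apply \<psi> a' \<noteq> 0" by (rule ex_dual_nonzero)
  define \<xi> where
    "\<xi> = (1 / dual_apply \<psi> a') *\<^sub>R (\<psi> - (\<Sum>b\<in>B. dual_apply \<psi> b *\<^sub>R d b))"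
  have \<xi>B: "dual_apply \<xi> c = 0" if "c \<in> B" for c
    using \<open>finite B\<close> that
    by (simp add: \<xi>_def dual_apply_simps dual_apply_sum d if_distrib sum.delta cong: if_cong)
  have \<xi>a: "dual_apply \<xi> a = 1"
  proof -
    have "dual_apply \<psi> a' = dual_apply \<psi> a - (\<Sum>b\<in>B. dual_apply (d b) a * dual_apply \<psi> b)"
      by (simp add: a'_def dual_apply_simps linear_sum[OF linear_dual_apply])
    then show ?thesis
      using \<psi> by (simp add: \<xi>_def dual_apply_simps dual_apply_sum mult.commute)
  qed
  define d' where "d' b = (if b = a then \<xi> else d b - dual_apply (d b) a *\<^sub>R \<xi>)" for b
  have "dual_apply (d' b) c = (if b = c then 1 else 0)" if "b \<in> insert a B" "c \<in> insert a B" for b c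
    using that insert.hyps(2) d \<xi>B \<xi>a by (auto simp: d'_def dual_apply_simps)
  then show ?case by blast
qed

text \<open>The functionals \<open>d b\<close> are continuous coordinates on \<open>span B\<close>;
  the finite-dimensional arguments are carried out with them instead of a norm on the
  subspace.\<close>

locale dual_basis =
  fixes B :: "'a::locally_convex_space set" and d :: "'a \<Rightarrow> 'a dual"
  assumes finite_B: "finite B"
    and biorthogonal: "b \<in> B \<Longrightarrow> c \<in> B \<Longrightarrow> dual_apply (d b) c = (if b = c then 1 else 0)"
begin

lemma biorthogonal_sum:
  assumes "c \<in> B"
  shows "(\<Sum>b\<in>B. w b * dual_apply (d b) c) = w c"
    and "dual_apply (d c) (\<Sum>b\<in>B. w b *\<^sub>R b) = w c"
  using assms finite_B
  by (simp_all add: linear_sum[OF linear_dual_apply] dual_apply_simps biorthogonal if_distrib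
      sum.delta sum.delta' cong: if_cong)

lemma span_expansion:
  assumes "u \<in> span B"
  shows "(\<Sum>b\<in>B. dual_apply (d b) u *\<^sub>R b) = u"
proof -
  obtain w where u: "u = (\<Sum>b\<in>B. w b *\<^sub>R b)"
    using assms finite_B by (auto simp: span_finite)
  show ?thesis by (subst (2) u) (simp add: u biorthogonal_sum cong: sum.cong)
qed

lemma dual_apply_span:
  assumes "u \<in> span B"
  shows "dual_apply \<phi> u = (\<Sum>b\<in>B. dual_apply (d b) u * dual_apply \<phi> b)"
proof -
  have "dual_apply \<phi> u = dual_apply \<phi> (\<Sum>b\<in>B. dual_apply (d b) u *\<^sub>R b)"
    by (simp add: span_expansion[OF assms])
  also have "\<dots> = (\<Sum>b\<in>B. dual_apply (d b) u * dual_apply \<phi> b)"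
    by (simp add: linear_sum[OF linear_dual_apply] dual_apply_simps)
  finally show ?thesis .
qed

end

section \<open>Bounded sets and the two topologies on the dual\<close>

lemma tvs_bounded_imp_dual_bounded:
  assumes "tvs_bounded C"
  obtains m where "m \<ge> 0" "\<And>c. c \<in> C \<Longrightarrow> \<bar>dual_apply \<phi> c\<bar> \<le> m"
proof -
  let ?U = "dual_apply \<phi> -` {-1<..<1}"
  have "open ?U" by (intro open_vimage continuous_on_dual_apply) simp
  moreover have "0 \<in> ?U" by (simp add: dual_apply_simps)
  ultimately obtain r where r: "r > 0" "\<And>s. r \<le> \<bar>s\<bar> \<Longrightarrow> C \<subseteq> (*\<^sub>R) s ` ?U"
    using assms unfolding tvs_bounded_def by blast
  have "\<bar>dual_apply \<phi> c\<bar> \<le> r" if "c \<in> C" for c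
  proof -
    have "C \<subseteq> (*\<^sub>R) r ` ?U" by (rule r(2)) simp
    then obtain u where "u \<in> ?U" "c = r *\<^sub>R u" using \<open>c \<in> C\<close> by blast
    then have "c = r *\<^sub>R u" "\<bar>dual_apply \<phi> u\<bar> < 1" by (simp_all add: abs_less_iff)
    then show ?thesis using r(1) by (simp add: dual_apply_simps abs_mult)
  qed
  then show thesis using that[of r] r(1) by simp
qed

lemma tvs_bounded_singleton: "tvs_bounded {x}"
  unfolding tvs_bounded_def
proof (intro allI impI)
  fix U :: "'a set" assume U: "open U \<and> 0 \<in> U"
  have "((\<lambda>r. r *\<^sub>R x) \<longlongrightarrow> 0 *\<^sub>R x) (nhds 0)"
    by (intro tendsto_scaleR_lcs tendsto_const filterlim_ident)
  then have "\<forall>\<^sub>F r in nhds 0. r *\<^sub>R x \<in> U"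
    using U by (intro topological_tendstoD) auto
  then obtain \<delta> where \<delta>: "\<delta> > 0" "\<And>r. \<bar>r\<bar> < \<delta> \<Longrightarrow> r *\<^sub>R x \<in> U"
    unfolding eventually_nhds_metric by (auto simp: dist_real_def)
  have "{x} \<subseteq> (*\<^sub>R) s ` U" if "2 / \<delta> \<le> \<bar>s\<bar>" for s
  proof -
    have "\<bar>s\<bar> > 0" using that \<delta>(1) by (smt (verit) divide_pos_pos)
    moreover have "2 \<le> \<bar>s\<bar> * \<delta>" using that \<delta>(1) by (simp add: pos_divide_le_eq)
    ultimately have "\<bar>1 / s\<bar> < \<delta>" by (simp add: field_simps)
    then have "(1 / s) *\<^sub>R x \<in> U" by (rule \<delta>(2))
    moreover have "x = s *\<^sub>R ((1 / s) *\<^sub>R x)" using \<open>\<bar>s\<bar> > 0\<close> by simp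
    ultimately show ?thesis by blast
  qed
  then show "\<exists>r>0. \<forall>s. r \<le> \<bar>s\<bar> \<longrightarrow> {x} \<subseteq> (*\<^sub>R) s ` U"
    using \<delta>(1) by (intro exI[of _ "2 / \<delta>"]) auto
qed

lemma topspace_strong_topology: "topspace strong_topology = UNIV"
proof -
  have "openin strong_topology (UNIV :: 'a dual set)"
    unfolding openin_strong_topology strong_open_def
    by (auto intro!: exI[of _ "{}"] exI[of _ 1] tvs_bounded_empty)
  then show ?thesis using openin_subset by blast
qed

lemma topspace_weak_star_topology: "topspace weak_star_topology = UNIV"
proof -
  have "openin weak_star_topology {\<phi> :: 'a dual. dual_apply \<phi> 0 \<in> UNIV}"
    unfolding weak_star_topology_def by (rule topology_generated_by_Basis) (use open_UNIV in blast)
  then show ?thesis using openin_subset by fastforce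
qed

text \<open>Singletons are bounded, so the generators of the weak-star topology are strongly open.
  Consequently, for both formulas, the inclusion of the subdifferential can be proved with strong
  closures and the converse with weak-star closures.\<close>

lemma strong_closure_subset_weak_star_closure:
  "strong_topology closure_of A \<subseteq> weak_star_topology closure_of A"
proof -
  have gen: "strong_open W" if W: "W \<in> {{\<phi>. dual_apply \<phi> x \<in> U} | x U. open U}" for W :: "'a dual set"
    unfolding strong_open_def
  proof
    fix \<phi> assume "\<phi> \<in> W"
    obtain x U where W: "W = {\<phi>. dual_apply \<phi> x \<in> U}" "open U" using W by blast
    then obtain e where e: "e > 0" "\<And>y. \<bar>y - dual_apply \<phi> x\<bar> < e \<Longrightarrow> y \<in> U"
      using \<open>\<phi> \<in> W\<close> unfolding open_dist by (auto simp: dist_real_def)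
    then show "\<exists>C. tvs_bounded C \<and> (\<exists>e>0. {\<psi>. \<forall>b\<in>C. \<bar>dual_apply \<psi> b - dual_apply \<phi> b\<bar> < e} \<subseteq> W)"
      by (intro exI[of _ "{x}"] conjI tvs_bounded_singleton exI[of _ e]) (auto simp: W)
  qed
  have "openin strong_topology W" if "openin weak_star_topology W" for W :: "'a dual set"
    unfolding openin_strong_topology
    using generate_topology_on_coarsest[OF istopology_strong_open gen] that
    by (simp only: weak_star_topology_def openin_topology_generated_by_iff)
  then show ?thesis
    by (auto simp: in_closure_of topspace_strong_topology topspace_weak_star_topology)
qed

lemma weak_star_closure_approx:
  assumes "\<phi> \<in> weak_star_topology closure_of A" "e > 0"
  obtains \<psi> where "\<psi> \<in> A" "\<bar>dual_apply \<psi> y - dual_apply \<phi> y\<bar> < e"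
proof -
  let ?W = "{\<psi>. dual_apply \<psi> y \<in> ball (dual_apply \<phi> y) e}"
  have "openin weak_star_topology ?W"
    unfolding weak_star_topology_def by (rule topology_generated_by_Basis) blast
  moreover have "\<phi> \<in> ?W" using \<open>e > 0\<close> by simp
  ultimately obtain \<psi> where "\<psi> \<in> A" "\<psi> \<in> ?W"
    using assms(1) in_closure_of[of \<phi>] by metis
  then show thesis using that[of \<psi>] by (auto simp: dist_real_def abs_minus_commute)
qed

context dual_basis
begin

text \<open>An element of \<open>A\<close> close to \<open>\<phi>\<close> on \<open>B\<close> only
  may be far away elsewhere. It is replaced by \<open>\<phi>\<close> plus a small combination of the
  \<open>d b\<close> having the same values on \<open>B\<close>: by saturation this is still in
  \<open>A\<close>, and it is uniformly close to \<open>\<phi>\<close> on a bounded set because the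
  \<open>d b\<close> are bounded there.\<close>

lemma in_strong_closureI:
  assumes saturated: "\<And>\<psi> \<nu>. \<psi> \<in> A \<Longrightarrow> \<forall>b\<in>B. dual_apply \<nu> b = 0 \<Longrightarrow> \<psi> + \<nu> \<in> A"
    and approx: "\<And>e. e > 0 \<Longrightarrow> \<exists>\<psi>\<in>A. \<forall>b\<in>B. \<bar>dual_apply \<psi> b - dual_apply \<phi> b\<bar> < e"
  shows "\<phi> \<in> strong_topology closure_of A"
  unfolding in_closure_of topspace_strong_topology openin_strong_topology
proof (intro conjI allI impI UNIV_I)
  fix W assume "\<phi> \<in> W \<and> strong_open W"
  then obtain C e where C: "tvs_bounded C" "e > 0"
    "{\<psi>. \<forall>c\<in>C. \<bar>dual_apply \<psi> c - dual_apply \<phi> c\<bar> < e} \<subseteq> W"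
    unfolding strong_open_def by blast
  have "\<forall>b. \<exists>m. m \<ge> 0 \<and> (\<forall>c\<in>C. \<bar>dual_apply (d b) c\<bar> \<le> m)"
    using tvs_bounded_imp_dual_bounded[OF C(1)] by metis
  then obtain m where m: "\<And>b. m b \<ge> 0" "\<And>b c. c \<in> C \<Longrightarrow> \<bar>dual_apply (d b) c\<bar> \<le> m b" by metis
  define M where "M = (\<Sum>b\<in>B. m b)"
  have "M \<ge> 0" unfolding M_def by (intro sum_nonneg m)
  \<comment> \<open>The summand 1 covers the case \<open>M = 0\<close>, for instance when
    \<open>B\<close> is empty.\<close>
  define e' where "e' = e / (M + 1)"
  have e': "e' > 0" "e' * M < e" using \<open>M \<ge> 0\<close> \<open>e > 0\<close> by (auto simp: e'_def field_simps)
  obtain \<psi>\<^sub>0 where \<psi>\<^sub>0: "\<psi>\<^sub>0 \<in> A" "\<And>b. b \<in> B \<Longrightarrow> \<bar>dual_apply \<psi>\<^sub>0 b - dual_apply \<phi> b\<bar> < e'"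
    using approx[OF e'(1)] by blast
  define \<psi> where "\<psi> = \<phi> + (\<Sum>b\<in>B. (dual_apply \<psi>\<^sub>0 b - dual_apply \<phi> b) *\<^sub>R d b)"
  have "dual_apply (\<psi> - \<psi>\<^sub>0) b = 0" if "b \<in> B" for b
    by (simp add: \<psi>_def dual_apply_simps dual_apply_sum biorthogonal_sum(1)[OF that])
  then have "\<psi>\<^sub>0 + (\<psi> - \<psi>\<^sub>0) \<in> A" by (intro saturated \<psi>\<^sub>0(1)) blast
  then have "\<psi> \<in> A" by simp
  moreover have "\<bar>dual_apply \<psi> c - dual_apply \<phi> c\<bar> < e" if "c \<in> C" for c
  proof -
    have "\<bar>dual_apply \<psi> c - dual_apply \<phi> c\<bar>
        = \<bar>\<Sum>b\<in>B. (dual_apply \<psi>\<^sub>0 b - dual_apply \<phi> b) * dual_apply (d b) c\<bar>"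
      by (simp add: \<psi>_def dual_apply_simps dual_apply_sum)
    also have "\<dots> \<le> (\<Sum>b\<in>B. \<bar>(dual_apply \<psi>\<^sub>0 b - dual_apply \<phi> b) * dual_apply (d b) c\<bar>)"
      by (rule sum_abs)
    also have "\<dots> \<le> (\<Sum>b\<in>B. e' * m b)"
      unfolding abs_mult
      by (intro sum_mono mult_mono) (use \<psi>\<^sub>0(2) m that e'(1) in \<open>auto intro: less_imp_le\<close>)
    also have "\<dots> = e' * M" by (simp add: M_def sum_distrib_left)
    finally show ?thesis using e'(2) by simp
  qed
  ultimately show "\<exists>\<psi>. \<psi> \<in> A \<and> \<psi> \<in> W" using C(3) by blast
qed

text \<open>The separating \<open>\<Psi>\<close> is a linear form on the dual without any
  continuity. Being bounded above on \<open>W\<close>, it vanishes on the annihilator of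
  \<open>B\<close>, hence is a combination of evaluations at points of \<open>B\<close>, that is,
  evaluation at one vector \<open>v\<close>.\<close>

lemma dual_separation:
  assumes "e > 0" and far: "\<And>\<psi>. \<psi> \<in> convex hull A \<Longrightarrow> \<exists>b\<in>B. \<bar>dual_apply \<psi> b - dual_apply \<phi> b\<bar> \<ge> e"
  obtains v \<beta> where "v \<in> span B" "\<beta> > 0" "\<And>\<psi>. \<psi> \<in> A \<Longrightarrow> dual_apply \<psi> v \<le> dual_apply \<phi> v - \<beta>"
proof (cases "A = {}")
  case True
  then show thesis using that[of 0 1] span_zero by auto
next
  case False
  define W where "W = {\<omega>. \<forall>b\<in>B. \<bar>dual_apply \<omega> b\<bar> < e}"
  have W0: "0 \<in> W" using \<open>e > 0\<close> by (simp add: W_def dual_apply_simps)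
  have "W = (\<Inter>b\<in>B. (\<lambda>\<omega>. dual_apply \<omega> b) -` {-e<..<e})" by (auto simp: W_def abs_less_iff)
  then have Wconvex: "convex W"
    by (auto intro!: convex_INT convex_linear_vimage linear_evaluation)
  have Wabsorb: "\<exists>r>0. r *\<^sub>R \<omega> \<in> W" for \<omega>
  proof -
    define m where "m = (\<Sum>b\<in>B. \<bar>dual_apply \<omega> b\<bar>)"
    have "m \<ge> 0" unfolding m_def by (intro sum_nonneg) simp
    have "\<bar>dual_apply \<omega> b\<bar> \<le> m" if "b \<in> B" for b
      unfolding m_def by (rule member_le_sum[OF that]) (auto simp: finite_B)
    moreover have "e / (m + 1) * x < e" if "x \<le> m" for x
    proof -
      have "e * x < e * (m + 1)" using that \<open>e > 0\<close> by simp
      then show ?thesis using \<open>m \<ge> 0\<close> by (simp add: pos_divide_less_eq)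
    qed
    ultimately have "e / (m + 1) * \<bar>dual_apply \<omega> b\<bar> < e" if "b \<in> B" for b
      using that by blast
    then have "(e / (m + 1)) *\<^sub>R \<omega> \<in> W"
      using \<open>m \<ge> 0\<close> \<open>e > 0\<close> by (auto simp: W_def dual_apply_simps abs_mult)
    then show ?thesis using \<open>m \<ge> 0\<close> \<open>e > 0\<close> by (intro exI[of _ "e / (m + 1)"]) simp
  qed
  have "\<phi> - \<omega> \<notin> convex hull A" if "\<omega> \<in> W" for \<omega>
    using far[of "\<phi> - \<omega>"] that by (fastforce simp: W_def dual_apply_simps)
  then obtain \<Psi> :: "'a dual \<Rightarrow> real" and \<eta> where \<Psi>: "linear \<Psi>" "\<And>\<omega>. \<omega> \<in> W \<Longrightarrow> \<Psi> \<omega> \<le> 1"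
    and \<eta>: "\<eta> > 0" "\<And>\<psi>. \<psi> \<in> convex hull A \<Longrightarrow> \<Psi> \<psi> + \<eta> \<le> \<Psi> \<phi>"
    using absorbing_strict_separation[OF convex_convex_hull _ Wconvex W0 Wabsorb] False
    by (metis convex_hull_eq_empty)
  \<comment> \<open>Every multiple of such a \<open>\<nu>\<close> lies in \<open>W\<close>; the one
    on which \<open>\<Psi>\<close> takes the value 2 would violate the bound 1.\<close>
  have null: "\<Psi> \<nu> = 0" if "\<And>b. b \<in> B \<Longrightarrow> dual_apply \<nu> b = 0" for \<nu>
  proof (rule ccontr)
    assume "\<Psi> \<nu> \<noteq> 0"
    have "(2 / \<Psi> \<nu>) *\<^sub>R \<nu> \<in> W" using that \<open>e > 0\<close> by (simp add: W_def dual_apply_simps)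
    from \<Psi>(2)[OF this] \<open>\<Psi> \<nu> \<noteq> 0\<close> show False by (simp add: linear_cmul[OF \<Psi>(1)])
  qed
  define v where "v = (\<Sum>b\<in>B. \<Psi> (d b) *\<^sub>R b)"
  have \<Psi>v: "\<Psi> \<psi> = dual_apply \<psi> v" for \<psi>
  proof -
    have "\<Psi> (\<psi> - (\<Sum>b\<in>B. dual_apply \<psi> b *\<^sub>R d b)) = 0"
      by (rule null) (simp add: dual_apply_simps dual_apply_sum biorthogonal_sum(1))
    then have "\<Psi> \<psi> = (\<Sum>b\<in>B. dual_apply \<psi> b * \<Psi> (d b))"
      by (simp add: linear_diff[OF \<Psi>(1)] linear_sum[OF \<Psi>(1)] linear_cmul[OF \<Psi>(1)])
    also have "\<dots> = dual_apply \<psi> v"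
      by (simp add: v_def linear_sum[OF linear_dual_apply] dual_apply_simps mult.commute)
    finally show ?thesis .
  qed
  show thesis
  proof (rule that[of v \<eta>])
    show "v \<in> span B" unfolding v_def by (intro span_sum span_scale span_base)
    show "dual_apply \<psi> v \<le> dual_apply \<phi> v - \<eta>" if "\<psi> \<in> A" for \<psi>
      using \<eta>(2)[OF hull_inc[OF that]] by (simp add: \<Psi>v)
  qed fact
qed

end

subsection \<open>Convex hulls of closures\<close>

text \<open>In a representation with the fewest points, more than \<open>Suc (card F)\<close> points
  would be affinely dependent, and shifting the weights along the dependence \<open>w\<close> would
  remove one of them.\<close>

lemma caratheodory_span:
  fixes S :: "'a::real_vector set"
  assumes "finite F" "S \<subseteq> span F" "p \<in> convex hull S"
  shows "\<exists>T u. finite T \<and> T \<subseteq> S \<and> card T \<le> Suc (card F) \<and> (\<forall>v\<in>T. 0 \<le> u v) \<and>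
    sum u T = 1 \<and> (\<Sum>v\<in>T. u v *\<^sub>R v) = p"
proof -
  define R where "R T \<longleftrightarrow> finite T \<and> T \<subseteq> S \<and>
    (\<exists>u. (\<forall>v\<in>T. 0 \<le> u v) \<and> sum u T = 1 \<and> (\<Sum>v\<in>T. u v *\<^sub>R v) = p)" for T
  obtain T0 where "R T0" using assms(3) unfolding convex_hull_explicit R_def by blast
  then obtain T where "R T" and min: "\<And>T'. R T' \<Longrightarrow> card T \<le> card T'"
    using ex_has_least_nat[of R T0 card] by metis
  then obtain u where T: "finite T" "T \<subseteq> S"
    and u: "\<And>v. v \<in> T \<Longrightarrow> 0 \<le> u v" "sum u T = 1" "(\<Sum>v\<in>T. u v *\<^sub>R v) = p"
    unfolding R_def by blast
  have "card T \<le> Suc (card F)"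
  proof (rule ccontr)
    assume *: "\<not> card T \<le> Suc (card F)"
    then obtain a where "a \<in> T" by force
    let ?D = "{v - a | v. v \<in> T - {a}}"
    have "?D = (\<lambda>v. v - a) ` (T - {a})" by auto
    then have "card ?D = card (T - {a})" by (simp add: card_image inj_on_def)
    then have "card ?D > card F" using * T \<open>a \<in> T\<close> by simp
    moreover have "?D \<subseteq> span F" using T assms(2) \<open>a \<in> T\<close> by (auto intro!: span_diff)
    ultimately have "dependent ?D" using independent_span_bound[OF assms(1), of ?D] by auto
    then have "affine_dependent (insert a (T - {a}))" by (intro dependent_imp_affine_dependent) auto
    then have "affine_dependent T" using \<open>a \<in> T\<close> by (simp add: insert_absorb)
    then obtain w where w: "sum w T = 0" "\<exists>v\<in>T. w v \<noteq> 0" "(\<Sum>v\<in>T. w v *\<^sub>R v) = 0"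
      using T by (auto simp: affine_dependent_explicit_finite)
    define P where "P = {v \<in> T. w v > 0}"
    have "P \<noteq> {}"
    proof
      assume "P = {}"
      then have "\<And>v. v \<in> T \<Longrightarrow> w v \<le> 0" by (force simp: P_def)
      then have "\<And>v. v \<in> T \<Longrightarrow> w v = 0" using w(1) sum_nonneg_eq_0_iff[OF T(1), of "\<lambda>v. - w v"] by (simp add: sum_negf)
      then show False using w(2) by blast
    qed
    moreover have "finite P" using T by (simp add: P_def)
    ultimately obtain v0 where v0: "v0 \<in> P" "\<And>v. v \<in> P \<Longrightarrow> u v0 / w v0 \<le> u v / w v"
      using ex_is_arg_min_if_finite[of P "\<lambda>v. u v / w v"] by (auto simp: is_arg_min_linorder)
    \<comment> \<open>The minimal ratio is the largest step along \<open>- w\<close> that keeps all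
      weights nonnegative; the weight of \<open>v0\<close> becomes zero.\<close>
    define t where "t = u v0 / w v0"
    have v0T: "v0 \<in> T" "w v0 > 0" using v0 by (auto simp: P_def)
    then have "t \<ge> 0" using u(1) by (simp add: t_def)
    define u' where "u' v = u v - t * w v" for v
    have "u' v0 = 0" using v0T by (simp add: u'_def t_def)
    have nonneg: "0 \<le> u' v" if "v \<in> T" for v
    proof (cases "w v > 0")
      case True
      then have "t \<le> u v / w v" using v0(2)[of v] that by (simp add: P_def t_def)
      then show ?thesis using True by (simp add: u'_def field_simps)
    next
      case False
      then have "t * w v \<le> 0" using \<open>t \<ge> 0\<close> by (simp add: mult_nonneg_nonpos)
      then show ?thesis using u(1)[OF that] by (simp add: u'_def)
    qed
    have "sum u' T = 1" using w(1) u(2) by (simp add: u'_def sum_subtractf flip: sum_distrib_left)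
    then have s1: "sum u' (T - {v0}) = 1"
      using sum.remove[OF T(1) v0T(1), of u'] \<open>u' v0 = 0\<close> by simp
    have "(\<Sum>v\<in>T. u' v *\<^sub>R v) = (\<Sum>v\<in>T. u v *\<^sub>R v) - t *\<^sub>R (\<Sum>v\<in>T. w v *\<^sub>R v)"
      by (simp add: u'_def scaleR_left_diff_distrib sum_subtractf scaleR_sum_right)
    then have "(\<Sum>v\<in>T. u' v *\<^sub>R v) = p" using w(3) u(3) by simp
    then have s2: "(\<Sum>v\<in>T - {v0}. u' v *\<^sub>R v) = p"
      using sum.remove[OF T(1) v0T(1), of "\<lambda>v. u' v *\<^sub>R v"] \<open>u' v0 = 0\<close> by simp
    have "R (T - {v0})" unfolding R_def using T nonneg s1 s2 by (intro conjI exI[of _ u']) auto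
    then have "card T \<le> card (T - {v0})" by (rule min)
    then show False using card_Diff1_less[OF T(1) v0T(1)] by simp
  qed
  then show ?thesis using T u by blast
qed

text \<open>The index set \<open>{..n}\<close> does not depend on \<open>p\<close>, so sequences of
  convex combinations can be passed to the limit term by term. Surplus indices repeat the point
  \<open>h 0\<close> with weight 0.\<close>

lemma caratheodory_indexed:
  fixes S :: "'a::real_vector set"
  assumes "finite F" "S \<subseteq> span F" "p \<in> convex hull S" "card F \<le> n"
  shows "\<exists>(a :: nat \<Rightarrow> 'a) u. (\<forall>i. a i \<in> S) \<and> (\<forall>i. 0 \<le> u i) \<and> (\<Sum>i\<le>n. u i) = 1 \<and>
    (\<Sum>i\<le>n. u i *\<^sub>R a i) = p"
proof -
  obtain T w where T: "finite T" "T \<subseteq> S" "card T \<le> Suc (card F)" "\<And>v. v \<in> T \<Longrightarrow> 0 \<le> w v"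
    "sum w T = 1" "(\<Sum>v\<in>T. w v *\<^sub>R v) = p"
    using caratheodory_span[OF assms(1-3)] by blast
  obtain h where h: "bij_betw h {0..<card T} T" using ex_bij_betw_nat_finite[OF T(1)] by blast
  have "T \<noteq> {}" using T(5) by auto
  then have pos: "card T > 0" using T(1) by (simp add: card_gt_0_iff)
  have hT: "h i \<in> T" if "i < card T" for i using bij_betwE[OF h] that by auto
  define a where "a i = h (if i < card T then i else 0)" for i
  define u where "u i = (if i < card T then w (h i) else 0)" for i
  have sub: "{0..<card T} \<subseteq> {..n}" using T(3) assms(4) by auto
  have red: "(\<Sum>i\<le>n. g i) = (\<Sum>i\<in>{0..<card T}. g i)"
    if "\<And>i. \<not> i < card T \<Longrightarrow> g i = 0" for g :: "nat \<Rightarrow> 'b::comm_monoid_add"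
    by (rule sum.mono_neutral_right[OF _ sub]) (use that in auto)
  show ?thesis
  proof (intro exI[of _ a] exI[of _ u] conjI allI)
    show "a i \<in> S" for i using hT pos T(2) by (auto simp: a_def)
    show "0 \<le> u i" for i using hT T(4) by (auto simp: u_def)
    have "(\<Sum>i\<le>n. u i) = (\<Sum>i\<in>{0..<card T}. w (h i))"
      by (subst red) (auto simp: u_def)
    then show "(\<Sum>i\<le>n. u i) = 1" using sum.reindex_bij_betw[OF h, of w] T(5) by simp
    have "(\<Sum>i\<le>n. u i *\<^sub>R a i) = (\<Sum>i\<in>{0..<card T}. w (h i) *\<^sub>R h i)"
      by (subst red) (auto simp: u_def a_def)
    then show "(\<Sum>i\<le>n. u i *\<^sub>R a i) = p"
      using sum.reindex_bij_betw[OF h, of "\<lambda>v. w v *\<^sub>R v"] T(6) by simp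
  qed
qed

lemma common_convergent_subsequence:
  fixes f :: "'j \<Rightarrow> nat \<Rightarrow> real"
  assumes "finite J" "\<And>j. j \<in> J \<Longrightarrow> bounded (range (f j))"
  shows "\<exists>r l. strict_mono r \<and> (\<forall>j\<in>J. (\<lambda>k. f j (r k)) \<longlonglongrightarrow> l j)"
  using assms
proof (induction J rule: finite_induct)
  case empty
  show ?case by (intro exI[of _ id]) (simp add: strict_mono_def)
next
  case (insert i J)
  then obtain r l where r: "strict_mono r" "\<And>j. j \<in> J \<Longrightarrow> (\<lambda>k. f j (r k)) \<longlonglongrightarrow> l j" by blast
  have "range (\<lambda>k. f i (r k)) \<subseteq> range (f i)" by auto
  then have "bounded (range (\<lambda>k. f i (r k)))"
    using insert.prems by (blast intro: bounded_subset)
  then obtain m s where s: "strict_mono s" "((\<lambda>k. f i (r k)) \<circ> s) \<longlonglongrightarrow> m"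
    using bounded_imp_convergent_subsequence by blast
  have "(\<lambda>k. f j (r (s k))) \<longlonglongrightarrow> l j" if "j \<in> J" for j
    using LIMSEQ_subseq_LIMSEQ[OF r(2)[OF that] s(1)] by (simp add: o_def)
  then have "\<forall>j\<in>insert i J. (\<lambda>k. f j ((r \<circ> s) k)) \<longlonglongrightarrow> (l(i := m)) j"
    using s(2) insert.hyps by (auto simp: o_def)
  then show ?case using strict_mono_o[OF r(1) s(1)] by blast
qed

context dual_basis
begin

text \<open>The dual may be infinite-dimensional, so Caratheodory's theorem is applied after the
  projection \<open>Q\<close> onto the span of the \<open>d b\<close>. It preserves values on
  \<open>B\<close>, which is why \<open>\<phi>\<close> is recovered on \<open>B\<close>
  only.\<close>

lemma dual_caratheodory:
  assumes "\<phi> \<in> convex hull A"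
  shows "\<exists>a u. (\<forall>i::nat. a i \<in> A) \<and> (\<forall>i. 0 \<le> u i) \<and> (\<Sum>i\<le>card B. u i) = 1 \<and>
    (\<forall>b\<in>B. (\<Sum>i\<le>card B. u i * dual_apply (a i) b) = dual_apply \<phi> b)"
proof -
  define Q where "Q \<psi> = (\<Sum>b\<in>B. dual_apply \<psi> b *\<^sub>R d b)" for \<psi>
  have QB: "dual_apply (Q \<psi>) b = dual_apply \<psi> b" if "b \<in> B" for \<psi> b
    by (simp add: Q_def dual_apply_simps dual_apply_sum biorthogonal_sum(1)[OF that])
  have "linear Q"
    by (rule linearI)
      (simp_all add: Q_def dual_apply_simps scaleR_add_left sum.distrib scaleR_sum_right)
  then have hull: "Q \<phi> \<in> convex hull (Q ` A)" using assms by (rule in_convex_hull_linear_image)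
  have sub: "Q ` A \<subseteq> span (d ` B)"
    unfolding Q_def by (intro image_subsetI span_sum span_scale) (auto intro: span_base)
  obtain c u where c: "\<forall>i. c i \<in> Q ` A" "\<forall>i. 0 \<le> u i" "(\<Sum>i\<le>card B. u i) = 1"
    "(\<Sum>i\<le>card B. u i *\<^sub>R c i) = Q \<phi>"
    using caratheodory_indexed[OF finite_imageI[OF finite_B] sub hull card_image_le[OF finite_B]]
    by (elim exE conjE)
  have "\<forall>i. \<exists>a. a \<in> A \<and> c i = Q a" using c(1) by blast
  then obtain a where a: "\<forall>i. a i \<in> A" "\<And>i. c i = Q (a i)" by metis
  show ?thesis
  proof (intro exI[of _ a] exI[of _ u] conjI ballI a(1) c(2,3))
    fix b assume "b \<in> B"
    have "dual_apply (\<Sum>i\<le>card B. u i *\<^sub>R c i) b = dual_apply (Q \<phi>) b" by (simp add: c(4))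
    then show "(\<Sum>i\<le>card B. u i * dual_apply (a i) b) = dual_apply \<phi> b"
      by (simp add: dual_apply_simps dual_apply_sum a(2) QB[OF \<open>b \<in> B\<close>])
  qed
qed

end

text \<open>The missing weight \<open>1 - sum a I\<close> is placed on 0.\<close>

lemma convex_sub_sum:
  fixes y :: "'i \<Rightarrow> 'a::real_vector"
  assumes "convex S" "0 \<in> S" "finite I" "\<And>i. i \<in> I \<Longrightarrow> a i \<ge> 0" "\<And>i. i \<in> I \<Longrightarrow> y i \<in> S"
    and "sum a I \<le> 1"
  shows "(\<Sum>i\<in>I. a i *\<^sub>R y i) \<in> S"
proof (cases "sum a I = 0")
  case True
  then have "a i = 0" if "i \<in> I" for i using that assms(3,4) by (simp add: sum_nonneg_eq_0_iff)
  then show ?thesis using assms(2) by simp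
next
  case False
  define c where "c = sum a I"
  have c: "c > 0" "c \<le> 1" using False assms(4,6) sum_nonneg[of I a] by (auto simp: c_def order_less_le)
  have "(\<Sum>i\<in>I. (a i / c) *\<^sub>R y i) \<in> S"
  proof (rule convex_sum[OF assms(3,1)])
    show "(\<Sum>i\<in>I. a i / c) = 1" using c by (simp add: c_def flip: sum_divide_distrib)
  qed (use assms c in auto)
  then have "c *\<^sub>R (\<Sum>i\<in>I. (a i / c) *\<^sub>R y i) + (1 - c) *\<^sub>R 0 \<in> S"
    using c assms(1,2) by (intro convexD) auto
  then show ?thesis using c by (simp add: scaleR_sum_right)
qed

context dual_basis
begin

lemma limit_in_convex_hull_closures:
  fixes A :: "real \<Rightarrow> 'a dual set"
  assumes "B \<subseteq> S" "S \<subseteq> span B"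
    and mono: "\<And>\<epsilon> \<epsilon>'. 0 < \<epsilon> \<Longrightarrow> \<epsilon> \<le> \<epsilon>' \<Longrightarrow> A \<epsilon> \<subseteq> A \<epsilon>'"
    and polar: "\<And>\<epsilon> \<psi> \<nu>. 0 < \<epsilon> \<Longrightarrow> \<psi> \<in> A \<epsilon> \<Longrightarrow> \<forall>s\<in>S. dual_apply \<nu> s \<le> 0 \<Longrightarrow> \<psi> + \<nu> \<in> A \<epsilon>"
    and bdd: "\<And>s. s \<in> S \<Longrightarrow> \<exists>C. \<forall>\<psi>\<in>A 1. dual_apply \<psi> s \<le> C"
    and approx: "\<And>\<epsilon> e. 0 < \<epsilon> \<Longrightarrow> 0 < e \<Longrightarrow>
      \<exists>\<psi>\<in>convex hull (A \<epsilon>). \<forall>b\<in>B. \<bar>dual_apply \<psi> b - dual_apply \<phi> b\<bar> < e"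
  shows "\<phi> \<in> convex hull (\<Inter>\<epsilon>\<in>{0<..}. strong_topology closure_of A \<epsilon>)"
proof -
  define n where "n = card B"
  \<comment> \<open>\<open>\<epsilon> k\<close> is both the level of the set and the accuracy on
    \<open>B\<close>; being at most 1, it keeps all functionals in \<open>A 1\<close>, where
    \<open>bdd\<close> applies.\<close>
  define \<epsilon> where "\<epsilon> k = inverse (real (Suc k))" for k
  have \<epsilon>: "0 < \<epsilon> k" "\<epsilon> k \<le> 1" for k by (simp_all add: \<epsilon>_def field_simps)
  have \<epsilon>0: "\<epsilon> \<longlonglongrightarrow> 0" unfolding \<epsilon>_def by (rule LIMSEQ_inverse_real_of_nat)
  define P where "P k a u \<longleftrightarrow> (\<forall>i. a i \<in> A (\<epsilon> k)) \<and> (\<forall>i. 0 \<le> u i) \<and> (\<Sum>i\<le>n. u i) = 1 \<and>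
      (\<forall>b\<in>B. \<bar>(\<Sum>i\<le>n. u i * dual_apply (a i) b) - dual_apply \<phi> b\<bar> < \<epsilon> k)" for k a u
  have "\<forall>k. \<exists>a u. P k a u"
  proof
    fix k
    obtain \<psi> where "\<psi> \<in> convex hull (A (\<epsilon> k))" "\<And>b. b \<in> B \<Longrightarrow> \<bar>dual_apply \<psi> b - dual_apply \<phi> b\<bar> < \<epsilon> k"
      using approx[OF \<epsilon>(1) \<epsilon>(1)] by blast
    moreover from dual_caratheodory[OF this(1)] obtain a u
      where "\<forall>i. a i \<in> A (\<epsilon> k)" "\<forall>i. 0 \<le> u i" "(\<Sum>i\<le>n. u i) = 1"
        "\<forall>b\<in>B. (\<Sum>i\<le>n. u i * dual_apply (a i) b) = dual_apply \<psi> b"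
      unfolding n_def by (elim exE conjE)
    ultimately show "\<exists>a u. P k a u" unfolding P_def by (intro exI[of _ a] exI[of _ u]) simp
  qed
  then obtain a u where "\<And>k. P k (a k) (u k)" by metis
  then have a: "\<And>k i. a k i \<in> A (\<epsilon> k)" and u: "\<And>k i. 0 \<le> u k i" "\<And>k. (\<Sum>i\<le>n. u k i) = 1"
    and au: "\<And>k b. b \<in> B \<Longrightarrow> \<bar>(\<Sum>i\<le>n. u k i * dual_apply (a k i) b) - dual_apply \<phi> b\<bar> < \<epsilon> k"
    unfolding P_def by blast+
  have a1: "a k i \<in> A 1" for k i using a[of k i] mono[OF \<epsilon>] by blast
  have u1: "u k i \<le> 1" if "i \<le> n" for k i
    using member_le_sum[of i "{..n}" "u k"] u that by simp
  \<comment> \<open>Nonnegative bounds are preserved when multiplied by weights at most 1.\<close>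
  have "\<forall>s\<in>S. \<exists>C. C \<ge> 0 \<and> (\<forall>\<psi>\<in>A 1. dual_apply \<psi> s \<le> C)"
  proof
    fix s assume "s \<in> S"
    then obtain c where "\<forall>\<psi>\<in>A 1. dual_apply \<psi> s \<le> c" using bdd by blast
    then show "\<exists>C\<ge>0. \<forall>\<psi>\<in>A 1. dual_apply \<psi> s \<le> C"
      by (intro exI[of _ "max 0 c"]) (auto intro: max.coboundedI2)
  qed
  then obtain C where C: "\<And>s. s \<in> S \<Longrightarrow> C s \<ge> 0" "\<And>s \<psi>. s \<in> S \<Longrightarrow> \<psi> \<in> A 1 \<Longrightarrow> dual_apply \<psi> s \<le> C s"
    by metis
  \<comment> \<open>Compactness is applied to these products: the functionals \<open>a k i\<close>
    themselves may be unbounded along indices whose weights tend to 0.\<close>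
  define x where "x i s k = u k i * dual_apply (a k i) s" for i s k
  have xC: "x i s k \<le> u k i * C s" if "s \<in> S" for i s k
    unfolding x_def using u C(2)[OF that a1] by (intro mult_left_mono) auto
  have xC': "x i s k \<le> C s" if "s \<in> S" "i \<le> n" for i s k
    using xC[OF that(1), of i k] mult_right_mono[OF u1[OF that(2)] C(1)[OF that(1)], of k] by simp
  have bx: "bounded (range (x i b))" if "b \<in> B" "i \<le> n" for i b
  proof -
    have "b \<in> S" using that(1) assms(1) by blast
    \<comment> \<open>The whole sum is within 1 of \<open>dual_apply \<phi> b\<close>, and each of
      the \<open>n\<close> other terms among \<open>n + 1\<close> is at most
      \<open>C b\<close>.\<close>
    have "dual_apply \<phi> b - 1 - real n * C b \<le> x i b k" for k
    proof -
      have "(\<Sum>j\<in>{..n} - {i}. x j b k) \<le> (\<Sum>j\<in>{..n} - {i}. C b)"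
        by (intro sum_mono xC'[OF \<open>b \<in> S\<close>]) auto
      also have "\<dots> = real n * C b" using that(2) by simp
      finally have "(\<Sum>j\<le>n. x j b k) \<le> x i b k + real n * C b"
        using sum.remove[of "{..n}" i "\<lambda>j. x j b k"] that(2) by simp
      then show ?thesis using au[OF that(1), of k] \<epsilon>(2)[of k] by (simp add: x_def)
    qed
    then have "range (x i b) \<subseteq> {dual_apply \<phi> b - 1 - real n * C b..C b}"
      using xC'[OF \<open>b \<in> S\<close> that(2)] by auto
    then show ?thesis by (rule bounded_subset[OF bounded_closed_interval])
  qed
  have bu: "bounded (range (\<lambda>k. u k i))" if "i \<le> n" for i
    using u u1[OF that] by (intro boundedI[of _ 1]) auto
  \<comment> \<open>\<open>None\<close> labels the weights and \<open>Some b\<close> the products at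
    \<open>b\<close>, so a single extraction makes all of them converge.\<close>
  define J where "J = {..n} \<times> insert None (Some ` B)"
  define f where "f = (\<lambda>(i, c) k. case c of None \<Rightarrow> u k i | Some b \<Rightarrow> x i b k)"
  have "finite J" using finite_B by (simp add: J_def)
  moreover have "bounded (range (f j))" if "j \<in> J" for j
    using that bx bu by (auto simp: J_def f_def)
  ultimately obtain r l where r: "strict_mono r" "\<And>j. j \<in> J \<Longrightarrow> (\<lambda>k. f j (r k)) \<longlonglongrightarrow> l j"
    using common_convergent_subsequence[of J f] by blast
  define \<mu> where "\<mu> i = l (i, None)" for i
  define \<Xi> where "\<Xi> i = (\<Sum>b\<in>B. l (i, Some b) *\<^sub>R d b)" for i
  have lim_u: "(\<lambda>k. u (r k) i) \<longlonglongrightarrow> \<mu> i" if "i \<le> n" for i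
    using r(2)[of "(i, None)"] that by (simp add: J_def f_def \<mu>_def)
  have lim_xb: "(\<lambda>k. x i b (r k)) \<longlonglongrightarrow> dual_apply (\<Xi> i) b" if "i \<le> n" "b \<in> B" for i b
    using r(2)[of "(i, Some b)"] that
    by (simp add: J_def f_def \<Xi>_def dual_apply_sum dual_apply_simps biorthogonal_sum(1)[OF that(2)])
  have lim_x: "(\<lambda>k. x i s (r k)) \<longlonglongrightarrow> dual_apply (\<Xi> i) s" if "i \<le> n" "s \<in> S" for i s
  proof -
    have s: "s \<in> span B" using that assms(2) by blast
    have "(\<lambda>k. \<Sum>b\<in>B. dual_apply (d b) s * x i b (r k)) \<longlonglongrightarrow> (\<Sum>b\<in>B. dual_apply (d b) s * dual_apply (\<Xi> i) b)"
      by (intro tendsto_intros lim_xb that(1))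
    moreover have "(\<Sum>b\<in>B. dual_apply (d b) s * x i b k) = x i s k" for k
      by (simp add: x_def dual_apply_span[OF s, of "a k i"] sum_distrib_left mult.left_commute)
    ultimately show ?thesis by (simp add: dual_apply_span[OF s, of "\<Xi> i"])
  qed
  have \<epsilon>r: "(\<lambda>k. \<epsilon> (r k)) \<longlonglongrightarrow> 0"
    using LIMSEQ_subseq_LIMSEQ[OF \<epsilon>0 r(1)] by (simp add: o_def)
  have \<mu>0: "\<mu> i \<ge> 0" if "i \<le> n" for i
    by (rule LIMSEQ_le_const[OF lim_u[OF that]]) (simp add: u)
  have "(\<lambda>k. \<Sum>i\<le>n. u (r k) i) \<longlonglongrightarrow> (\<Sum>i\<le>n. \<mu> i)" by (intro tendsto_sum lim_u) simp
  then have sum\<mu>: "(\<Sum>i\<le>n. \<mu> i) = 1" using u(2) by (simp add: LIMSEQ_const_iff)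
  have \<Xi>b: "(\<Sum>i\<le>n. dual_apply (\<Xi> i) b) = dual_apply \<phi> b" if "b \<in> B" for b
  proof -
    have l1: "(\<lambda>k. (\<Sum>i\<le>n. x i b (r k)) - dual_apply \<phi> b) \<longlonglongrightarrow> 0"
      by (rule Lim_null_comparison[OF _ \<epsilon>r]) (use au[OF that] in \<open>auto simp: x_def intro!: always_eventually less_imp_le\<close>)
    have l2: "(\<lambda>k. (\<Sum>i\<le>n. x i b (r k)) - dual_apply \<phi> b)
        \<longlonglongrightarrow> (\<Sum>i\<le>n. dual_apply (\<Xi> i) b) - dual_apply \<phi> b"
      by (intro tendsto_intros lim_xb that) simp
    show ?thesis using LIMSEQ_unique[OF l1 l2] by simp
  qed
  have \<Xi>s: "(\<Sum>i\<le>n. dual_apply (\<Xi> i) s) = dual_apply \<phi> s" if "s \<in> S" for s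
  proof -
    have s: "s \<in> span B" using that assms(2) by blast
    have "dual_apply (\<Sum>i\<le>n. \<Xi> i) s = dual_apply \<phi> s"
      unfolding dual_apply_span[OF s, of "\<Sum>i\<le>n. \<Xi> i"] dual_apply_span[OF s, of \<phi>]
      by (simp add: dual_apply_sum \<Xi>b)
    then show ?thesis by (simp add: dual_apply_sum)
  qed
  define I where "I = {i. i \<le> n \<and> \<mu> i > 0}"
  have I: "finite I" "I \<subseteq> {..n}" by (auto simp: I_def)
  have I0: "\<mu> i = 0" if "i \<in> {..n} - I" for i using that \<mu>0[of i] by (auto simp: I_def)
  have sumI: "(\<Sum>i\<in>I. \<mu> i) = 1"
    using sum.mono_neutral_left[of "{..n}" I \<mu>] I I0 sum\<mu> by auto
  \<comment> \<open>The limits sum to \<open>\<phi>\<close> on \<open>S\<close> only. Defining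
    \<open>\<nu>\<close> through \<open>\<phi>\<close> rather than by the terms of vanishing weight
    also absorbs the discrepancy outside \<open>S\<close>, so that the final identity holds in the
    dual.\<close>
  define \<nu> where "\<nu> = \<phi> - (\<Sum>i\<in>I. \<Xi> i)"
  have \<nu>: "dual_apply \<nu> s \<le> 0" if "s \<in> S" for s
  proof -
    have "dual_apply (\<Xi> i) s \<le> 0" if i: "i \<in> {..n} - I" for i
    proof (rule LIMSEQ_le[OF lim_x[OF _ \<open>s \<in> S\<close>]])
      have "(\<lambda>k. u (r k) i * C s) \<longlonglongrightarrow> \<mu> i * C s" using i by (intro tendsto_intros lim_u) simp
      then show "(\<lambda>k. u (r k) i * C s) \<longlonglongrightarrow> 0" using I0[OF i] by simp
    qed (use i xC[OF \<open>s \<in> S\<close>] in auto)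
    then have "(\<Sum>i\<in>{..n} - I. dual_apply (\<Xi> i) s) \<le> 0" by (rule sum_nonpos)
    moreover have "(\<Sum>i\<le>n. dual_apply (\<Xi> i) s)
        = (\<Sum>i\<in>{..n} - I. dual_apply (\<Xi> i) s) + (\<Sum>i\<in>I. dual_apply (\<Xi> i) s)"
      by (rule sum.subset_diff[OF I(2)]) simp
    ultimately show ?thesis using \<Xi>s[OF that] by (simp add: \<nu>_def dual_apply_simps dual_apply_sum)
  qed
  have closure: "(1 / \<mu> i) *\<^sub>R \<Xi> i + \<nu> \<in> strong_topology closure_of A \<epsilon>'" if "i \<in> I" "\<epsilon>' > 0" for i \<epsilon>'
  proof (rule in_strong_closureI)
    fix \<psi> \<omega> assume "\<psi> \<in> A \<epsilon>'" and \<omega>: "\<forall>b\<in>B. dual_apply \<omega> b = 0"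
    have "dual_apply \<omega> s = 0" if "s \<in> S" for s
      using that assms(2) \<omega> by (subst dual_apply_span) auto
    then show "\<psi> + \<omega> \<in> A \<epsilon>'" using polar[OF \<open>\<epsilon>' > 0\<close> \<open>\<psi> \<in> A \<epsilon>'\<close>] by simp
  next
    fix e :: real assume "e > 0"
    have i: "i \<le> n" "\<mu> i > 0" using that by (auto simp: I_def)
    have pos: "\<forall>\<^sub>F k in sequentially. u (r k) i > 0"
      using order_tendstoD(1)[OF lim_u[OF i(1)] i(2)] .
    have "\<forall>\<^sub>F k in sequentially. \<bar>dual_apply (a (r k) i) b - dual_apply (\<Xi> i) b / \<mu> i\<bar> < e"
      if "b \<in> B" for b
    proof -
      have "(\<lambda>k. x i b (r k) / u (r k) i) \<longlonglongrightarrow> dual_apply (\<Xi> i) b / \<mu> i"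
        using i by (intro tendsto_divide lim_xb lim_u that) auto
      from tendstoD[OF this \<open>e > 0\<close>] pos show ?thesis
        by eventually_elim (simp add: x_def dist_real_def)
    qed
    then have "\<forall>\<^sub>F k in sequentially. \<forall>b\<in>B. \<bar>dual_apply (a (r k) i) b - dual_apply (\<Xi> i) b / \<mu> i\<bar> < e"
      by (intro eventually_ball_finite finite_B) blast
    moreover have "\<forall>\<^sub>F k in sequentially. \<epsilon> (r k) < \<epsilon>'"
      using order_tendstoD(2)[OF \<epsilon>r \<open>\<epsilon>' > 0\<close>] .
    ultimately have "\<forall>\<^sub>F k in sequentially. \<epsilon> (r k) < \<epsilon>' \<and>
        (\<forall>b\<in>B. \<bar>dual_apply (a (r k) i) b - dual_apply (\<Xi> i) b / \<mu> i\<bar> < e)"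
      by eventually_elim blast
    then obtain k where k: "\<epsilon> (r k) < \<epsilon>'"
      "\<And>b. b \<in> B \<Longrightarrow> \<bar>dual_apply (a (r k) i) b - dual_apply (\<Xi> i) b / \<mu> i\<bar> < e"
      using eventually_happens'[OF sequentially_bot] by blast
    have "a (r k) i \<in> A \<epsilon>'" using a mono[OF \<epsilon>(1), of "r k" \<epsilon>'] k(1) by fastforce
    then have "a (r k) i + \<nu> \<in> A \<epsilon>'" using polar[OF \<open>\<epsilon>' > 0\<close>] \<nu> by blast
    then show "\<exists>\<psi>\<in>A \<epsilon>'. \<forall>b\<in>B. \<bar>dual_apply \<psi> b - dual_apply ((1 / \<mu> i) *\<^sub>R \<Xi> i + \<nu>) b\<bar> < e"
      using k(2) by (intro bexI[of _ "a (r k) i + \<nu>"]) (auto simp: dual_apply_simps)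
  qed
  have "(\<Sum>i\<in>I. \<mu> i *\<^sub>R ((1 / \<mu> i) *\<^sub>R \<Xi> i + \<nu>)) \<in> convex hull (\<Inter>\<epsilon>\<in>{0<..}. strong_topology closure_of A \<epsilon>)"
    using closure I sumI
    by (intro convex_sum convex_convex_hull) (auto simp: I_def intro!: hull_inc)
  moreover have "(\<Sum>i\<in>I. \<mu> i *\<^sub>R ((1 / \<mu> i) *\<^sub>R \<Xi> i + \<nu>)) = (\<Sum>i\<in>I. \<Xi> i + \<mu> i *\<^sub>R \<nu>)"
    by (intro sum.cong) (auto simp: I_def scaleR_add_right)
  moreover have "\<dots> = (\<Sum>i\<in>I. \<Xi> i) + (\<Sum>i\<in>I. \<mu> i) *\<^sub>R \<nu>"
    by (simp add: sum.distrib scaleR_left.sum)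
  ultimately show ?thesis by (simp add: sumI \<nu>_def)
qed


text \<open>Indexing by \<open>option\<close> keeps the weight of \<open>s\<close> apart from those
  of \<open>B\<close> even if \<open>s \<in> B\<close>; the remaining weight sits at 0.\<close>

lemma simplex_in_convex:
  assumes "convex S" "0 \<in> S" "B \<subseteq> S" "s \<in> S" "t \<ge> 0" "\<And>b. b \<in> B \<Longrightarrow> c b \<ge> 0" "t + sum c B \<le> 1"
  shows "t *\<^sub>R s + (\<Sum>b\<in>B. c b *\<^sub>R b) \<in> S"
proof -
  let ?I = "insert None (Some ` B)"
  let ?a = "\<lambda>i. case i of None \<Rightarrow> t | Some b \<Rightarrow> c b"
  let ?y = "\<lambda>i. case i of None \<Rightarrow> s | Some b \<Rightarrow> b"
  have split: "(\<Sum>i\<in>?I. g i) = g None + (\<Sum>b\<in>B. g (Some b))" for g :: "'a option \<Rightarrow> 'b::comm_monoid_add"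
    using finite_B by (simp add: sum.reindex)
  have "(\<Sum>i\<in>?I. ?a i *\<^sub>R ?y i) \<in> S"
    using assms finite_B by (intro convex_sub_sum) (auto simp: split)
  then show ?thesis by (simp add: split)
qed

text \<open>The hypothesis \<open>core\<close> is only required at relative interior points of \<open>S\<close>, in the algebraic sense.\<close>

lemma convex_hull_approx:
  fixes A :: "real \<Rightarrow> 'a dual set"
  assumes S: "convex S" "0 \<in> S" "B \<subseteq> S" "S \<subseteq> span B"
    and mono: "\<And>\<epsilon> \<epsilon>'. 0 < \<epsilon> \<Longrightarrow> \<epsilon> \<le> \<epsilon>' \<Longrightarrow> A \<epsilon> \<subseteq> A \<epsilon>'"
    and polar: "\<And>\<epsilon> \<psi> \<nu>. 0 < \<epsilon> \<Longrightarrow> \<psi> \<in> A \<epsilon> \<Longrightarrow> \<forall>s\<in>S. dual_apply \<nu> s \<le> 0 \<Longrightarrow> \<psi> + \<nu> \<in> A \<epsilon>"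
    and bdd: "\<And>s. s \<in> S \<Longrightarrow> \<exists>C. \<forall>\<psi>\<in>A 1. dual_apply \<psi> s \<le> C"
    and core: "\<And>\<epsilon> \<beta> v. 0 < \<epsilon> \<Longrightarrow> 0 < \<beta> \<Longrightarrow> v \<in> S \<Longrightarrow> (\<And>u. u \<in> span B \<Longrightarrow> \<exists>\<tau>>0. v + \<tau> *\<^sub>R u \<in> S) \<Longrightarrow>
      \<exists>\<psi>\<in>A \<epsilon>. dual_apply \<psi> v > dual_apply \<phi> v - \<beta>"
    and "0 < \<epsilon>" "0 < e"
  shows "\<exists>\<psi>\<in>convex hull (A \<epsilon>). \<forall>b\<in>B. \<bar>dual_apply \<psi> b - dual_apply \<phi> b\<bar> < e"
proof (rule ccontr)
  assume contra: "\<not> ?thesis"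
  \<comment> \<open>Truncation at 1 gives \<open>A \<delta> \<subseteq> A 1\<close>, so that
    \<open>bdd\<close> can be used.\<close>
  define \<delta> where "\<delta> = min \<epsilon> 1"
  have \<delta>: "\<delta> > 0" "\<delta> \<le> \<epsilon>" "\<delta> \<le> 1" using \<open>0 < \<epsilon>\<close> by (auto simp: \<delta>_def)
  have far: "\<exists>b\<in>B. \<bar>dual_apply \<psi> b - dual_apply \<phi> b\<bar> \<ge> e" if "\<psi> \<in> convex hull (A \<delta>)" for \<psi>
    using contra hull_mono[OF mono[OF \<delta>(1,2)], of convex] that by (meson not_le subsetD)
  define K where "K = {\<tau> *\<^sub>R s | \<tau> s. \<tau> \<ge> 0 \<and> s \<in> S}"
  have K: "\<tau> *\<^sub>R s \<in> K" if "\<tau> \<ge> 0" "s \<in> S" for \<tau> s using that by (auto simp: K_def)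
  have "0 \<in> K" using K[of 0 0] S(2) by simp
  have "convex K"
  proof (rule convexI)
    fix x y and p q :: real assume "x \<in> K" "y \<in> K" and pq: "p \<ge> 0" "q \<ge> 0" "p + q = 1"
    then obtain \<tau> s \<tau>' s' where *: "\<tau> \<ge> 0" "s \<in> S" "x = \<tau> *\<^sub>R s" "\<tau>' \<ge> 0" "s' \<in> S" "y = \<tau>' *\<^sub>R s'"
      by (auto simp: K_def)
    define c where "c = p * \<tau> + q * \<tau>'"
    show "p *\<^sub>R x + q *\<^sub>R y \<in> K"
    proof (cases "c = 0")
      case True
      then have "p * \<tau> = 0" "q * \<tau>' = 0"
        using * pq by (auto simp: c_def add_nonneg_eq_0_iff)
      then show ?thesis using \<open>0 \<in> K\<close> by (auto simp: *)
    next
      case False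
      then have "c > 0" using * pq by (auto simp: c_def order_less_le)
      have "(p * \<tau> / c) *\<^sub>R s + (q * \<tau>' / c) *\<^sub>R s' \<in> S"
        using * pq \<open>c > 0\<close> by (intro convexD[OF S(1)]) (auto simp: c_def simp flip: add_divide_distrib)
      then have "c *\<^sub>R ((p * \<tau> / c) *\<^sub>R s + (q * \<tau>' / c) *\<^sub>R s') \<in> K" using \<open>c > 0\<close> by (intro K) auto
      then show ?thesis using \<open>c > 0\<close> by (simp add: * scaleR_add_right)
    qed
  qed
  obtain v \<beta> where v: "v \<in> span B" "v \<in> closure K" and "\<beta> > 0"
    and le: "\<And>\<psi>. \<psi> \<in> A \<delta> \<Longrightarrow> dual_apply \<psi> v \<le> dual_apply \<phi> v - \<beta>"
  proof (cases "A \<delta> = {}")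
    \<comment> \<open>Here \<open>le\<close> holds vacuously for any \<open>v\<close>; the
      contradiction comes at the end, when \<open>core\<close> produces an element of
      \<open>A \<delta>\<close>.\<close>
    case True
    then show thesis using that[of 0 1] \<open>0 \<in> K\<close> closure_subset[of K] span_zero by auto
  next
    case False
    then obtain \<psi>\<^sub>0 where \<psi>\<^sub>0: "\<psi>\<^sub>0 \<in> A \<delta>" by blast
    obtain v \<beta> where v: "v \<in> span B" "\<beta> > 0" "\<And>\<psi>. \<psi> \<in> A \<delta> \<Longrightarrow> dual_apply \<psi> v \<le> dual_apply \<phi> v - \<beta>"
      using dual_separation[OF \<open>0 < e\<close> far] by blast
    have "v \<in> closure K"
    \<comment> \<open>A functional separating \<open>v\<close> from the cone is nonpositive on
      \<open>S\<close>, so its multiples can be added to \<open>\<psi>\<^sub>0\<close> without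
      leaving \<open>A \<delta>\<close>, while the value at \<open>v\<close> grows.\<close>
    proof (rule ccontr)
      assume "v \<notin> closure K"
      then obtain \<zeta> \<eta> where \<zeta>: "\<eta> > 0" "\<And>k. k \<in> K \<Longrightarrow> dual_apply \<zeta> k + \<eta> \<le> dual_apply \<zeta> v"
        using lcs_strict_separation[OF \<open>convex K\<close>] \<open>0 \<in> K\<close> by blast
      have \<zeta>v: "dual_apply \<zeta> v > 0" using \<zeta>(2)[OF \<open>0 \<in> K\<close>] \<zeta>(1) by (simp add: dual_apply_simps)
      have \<zeta>S: "dual_apply \<zeta> s \<le> 0" if "s \<in> S" for s
      proof (rule ccontr)
        assume "\<not> dual_apply \<zeta> s \<le> 0"
        then have "dual_apply \<zeta> ((dual_apply \<zeta> v / dual_apply \<zeta> s) *\<^sub>R s) + \<eta> \<le> dual_apply \<zeta> v"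
          using \<zeta>v that by (intro \<zeta>(2) K) auto
        then show False using \<zeta>(1) \<open>\<not> dual_apply \<zeta> s \<le> 0\<close> by (simp add: dual_apply_simps)
      qed
      \<comment> \<open>With this multiple the new value at \<open>v\<close> is at least
        \<open>dual_apply \<phi> v\<close>.\<close>
      define m where "m = \<bar>dual_apply \<phi> v - dual_apply \<psi>\<^sub>0 v\<bar> / dual_apply \<zeta> v"
      have "m \<ge> 0" using \<zeta>v by (simp add: m_def)
      then have "\<psi>\<^sub>0 + m *\<^sub>R \<zeta> \<in> A \<delta>"
        using \<zeta>S by (intro polar \<delta> \<psi>\<^sub>0) (auto simp: dual_apply_simps mult_nonneg_nonpos)
      from v(3)[OF this] show False using \<zeta>v v(2) by (simp add: dual_apply_simps m_def)
    qed
    with v show thesis using that by blast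
  qed
  have "\<forall>b\<in>B. \<exists>C. \<forall>\<psi>\<in>A 1. dual_apply \<psi> b \<le> C" using bdd S(3) by blast
  then obtain c where c: "\<And>b \<psi>. b \<in> B \<Longrightarrow> \<psi> \<in> A 1 \<Longrightarrow> dual_apply \<psi> b \<le> c b" by metis
  \<comment> \<open>On the sum of the vectors of \<open>B\<close>, elements of \<open>A 1\<close>
    exceed \<open>\<phi>\<close> by at most \<open>M\<close>. The choice of \<open>\<eta>\<close>
    makes the shift of \<open>v\<close> by \<eta> times this sum cost at most half of the margin
    \<beta>.\<close>
  define M where "M = sum c B - (\<Sum>b\<in>B. dual_apply \<phi> b)"
  define \<eta> where "\<eta> = \<beta> / (2 * (\<bar>M\<bar> + 1))"
  have "\<eta> > 0" using \<open>\<beta> > 0\<close> by (simp add: \<eta>_def)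
  have "\<eta> * M \<le> \<eta> * (\<bar>M\<bar> + 1)" using \<open>\<eta> > 0\<close> by simp
  also have "\<dots> = \<beta> / 2" by (simp add: \<eta>_def field_simps)
  finally have \<eta>M: "\<eta> * M \<le> \<beta> / 2" .
  \<comment> \<open>A point \<open>k\<close> of the cone in this neighbourhood has coordinates
    within \<open>\<eta> / 2\<close> of those of \<open>v\<close>, so the shifted vector exceeds
    \<open>k\<close> by more than \<open>\<eta> / 2\<close> in every coordinate.\<close>
  let ?U = "\<Inter>b\<in>B. (\<lambda>y. dual_apply (d b) (y - v)) -` {-(\<eta> / 2)<..<\<eta> / 2}"
  have "open ?U"
    by (intro open_INT finite_B ballI open_vimage open_greaterThanLessThan
        continuous_on_compose2[OF continuous_on_dual_apply] continuous_intros) auto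
  moreover have "v \<in> ?U" using \<open>\<eta> > 0\<close> by (simp add: dual_apply_simps)
  ultimately obtain k where k: "k \<in> K" "k \<in> ?U"
    using v(2) unfolding closure_iff_nhds_not_empty by (metis Int_iff ex_in_conv subset_refl)
  obtain \<tau> s where \<tau>: "\<tau> \<ge> 0" "s \<in> S" "k = \<tau> *\<^sub>R s" using k(1) by (auto simp: K_def)
  define w where "w b = dual_apply (d b) (v - k) + \<eta>" for b
  have w: "w b > \<eta> / 2" if "b \<in> B" for b
    using k(2) that by (auto simp: w_def dual_apply_simps)
  have "v - k \<in> span B" using v(1) \<tau> S(4) by (auto intro: span_diff span_scale)
  then have vk: "v + \<eta> *\<^sub>R (\<Sum>b\<in>B. b) = \<tau> *\<^sub>R s + (\<Sum>b\<in>B. w b *\<^sub>R b)"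
    using span_expansion[of "v - k"]
    by (simp add: w_def scaleR_add_left sum.distrib scaleR_sum_right \<tau>(3)[symmetric])
  define W where "W = sum w B"
  have "W \<ge> 0" unfolding W_def using w \<open>\<eta> > 0\<close> by (intro sum_nonneg) (smt (verit) half_gt_zero)
  \<comment> \<open>Scaling by \<sigma> leaves at least half of the unit mass free for the
    perturbation in \<open>near\<close>; the summand 1 covers \<open>\<tau> + W = 0\<close>.\<close>
  define \<sigma> where "\<sigma> = 1 / (2 * (\<tau> + W) + 1)"
  have \<sigma>: "\<sigma> > 0" "\<sigma> * (\<tau> + W) \<le> 1 / 2" using \<tau>(1) \<open>W \<ge> 0\<close> by (auto simp: \<sigma>_def field_simps)
  define v' where "v' = \<sigma> *\<^sub>R (v + \<eta> *\<^sub>R (\<Sum>b\<in>B. b))"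
  have near: "\<exists>\<rho>>0. v' + \<rho> *\<^sub>R u \<in> S" if "u \<in> span B" for u
  proof -
    define m where "m = (\<Sum>b\<in>B. \<bar>dual_apply (d b) u\<bar>)"
    have "m \<ge> 0" unfolding m_def by (intro sum_nonneg) simp
    \<comment> \<open>The first bound keeps all coefficients nonnegative, the second keeps the total
      mass at most 1.\<close>
    define \<rho> where "\<rho> = min (\<sigma> * \<eta> / 2) (1 / 2) / (m + 1)"
    have "\<rho> > 0" using \<open>m \<ge> 0\<close> \<sigma>(1) \<open>\<eta> > 0\<close> by (simp add: \<rho>_def)
    have "\<rho> * m \<le> \<rho> * (m + 1)" using \<open>\<rho> > 0\<close> by simp
    also have "\<dots> = min (\<sigma> * \<eta> / 2) (1 / 2)" using \<open>m \<ge> 0\<close> by (simp add: \<rho>_def)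
    finally have \<rho>m: "\<rho> * m \<le> \<sigma> * \<eta> / 2" "\<rho> * m \<le> 1 / 2" by auto
    have "\<bar>dual_apply (d b) u\<bar> \<le> m" if "b \<in> B" for b
      unfolding m_def by (rule member_le_sum[OF that]) (auto simp: finite_B)
    then have ub: "\<rho> * \<bar>dual_apply (d b) u\<bar> \<le> \<sigma> * \<eta> / 2" if "b \<in> B" for b
      using \<rho>m(1) \<open>\<rho> > 0\<close> that by (meson less_imp_le mult_left_mono order_trans)
    have "(\<sigma> * \<tau>) *\<^sub>R s + (\<Sum>b\<in>B. (\<sigma> * w b + \<rho> * dual_apply (d b) u) *\<^sub>R b) \<in> S"
    proof (rule simplex_in_convex[OF S(1-3) \<tau>(2)])
      show "0 \<le> \<sigma> * \<tau>" using \<sigma> \<tau> by simp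
      fix b assume "b \<in> B"
      have "\<sigma> * (\<eta> / 2) \<le> \<sigma> * w b" using w[OF \<open>b \<in> B\<close>] \<sigma>(1) by simp
      moreover have "- (\<rho> * dual_apply (d b) u) \<le> \<rho> * \<bar>dual_apply (d b) u\<bar>"
        using \<open>\<rho> > 0\<close> by (simp add: abs_if mult_left_mono)
      ultimately show "0 \<le> \<sigma> * w b + \<rho> * dual_apply (d b) u"
        using ub[OF \<open>b \<in> B\<close>] by simp
    next
      have "(\<Sum>b\<in>B. \<rho> * dual_apply (d b) u) \<le> (\<Sum>b\<in>B. \<rho> * \<bar>dual_apply (d b) u\<bar>)"
        using \<open>\<rho> > 0\<close> by (intro sum_mono mult_left_mono) auto
      also have "\<dots> = \<rho> * m" by (simp add: m_def sum_distrib_left)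
      finally show "\<sigma> * \<tau> + (\<Sum>b\<in>B. \<sigma> * w b + \<rho> * dual_apply (d b) u) \<le> 1"
        using \<rho>m(2) \<sigma>(2) by (simp add: sum.distrib W_def distrib_left sum_distrib_left)
    qed
    moreover have "v' + \<rho> *\<^sub>R u = (\<sigma> * \<tau>) *\<^sub>R s + (\<Sum>b\<in>B. (\<sigma> * w b + \<rho> * dual_apply (d b) u) *\<^sub>R b)"
    proof -
      have "\<rho> *\<^sub>R u = (\<Sum>b\<in>B. (\<rho> * dual_apply (d b) u) *\<^sub>R b)"
        by (subst span_expansion[OF that, symmetric]) (simp add: scaleR_sum_right)
      moreover have "v' = (\<sigma> * \<tau>) *\<^sub>R s + (\<Sum>b\<in>B. (\<sigma> * w b) *\<^sub>R b)"
        unfolding v'_def vk by (simp add: scaleR_add_right scaleR_sum_right)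
      ultimately show ?thesis by (simp add: scaleR_add_left sum.distrib)
    qed
    ultimately show ?thesis using \<open>\<rho> > 0\<close> by auto
  qed
  have "v' \<in> S" using near[OF span_zero] by simp
  \<comment> \<open>The tolerance is the remaining margin \<open>\<beta> / 2\<close>, scaled by
    \<sigma> like \<open>v'\<close>.\<close>
  then obtain \<psi> where \<psi>: "\<psi> \<in> A \<delta>" "dual_apply \<psi> v' > dual_apply \<phi> v' - \<sigma> * \<beta> / 2"
    using core[OF \<delta>(1) _ _ near, of "\<sigma> * \<beta> / 2"] \<sigma>(1) \<open>\<beta> > 0\<close> by auto
  have v'_eval: "dual_apply \<omega> v' = \<sigma> * (dual_apply \<omega> v + \<eta> * (\<Sum>b\<in>B. dual_apply \<omega> b))" for \<omega>
    by (simp add: v'_def dual_apply_simps linear_sum[OF linear_dual_apply])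
  have "\<psi> \<in> A 1" using \<psi>(1) mono[OF \<delta>(1,3)] by blast
  then have "(\<Sum>b\<in>B. dual_apply \<psi> b) \<le> sum c B" by (intro sum_mono c)
  then have "\<eta> * (\<Sum>b\<in>B. dual_apply \<psi> b) \<le> \<eta> * sum c B" using \<open>\<eta> > 0\<close> by simp
  moreover have "\<eta> * sum c B - \<eta> * (\<Sum>b\<in>B. dual_apply \<phi> b) \<le> \<beta> / 2"
    using \<eta>M by (simp add: M_def right_diff_distrib)
  ultimately have "dual_apply \<psi> v + \<eta> * (\<Sum>b\<in>B. dual_apply \<psi> b)
      \<le> dual_apply \<phi> v + \<eta> * (\<Sum>b\<in>B. dual_apply \<phi> b) - \<beta> / 2"
    using le[OF \<psi>(1)] by linarith
  then have "dual_apply \<psi> v' \<le> \<sigma> * (dual_apply \<phi> v + \<eta> * (\<Sum>b\<in>B. dual_apply \<phi> b) - \<beta> / 2)"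
    unfolding v'_eval using \<sigma>(1) by (intro mult_left_mono) auto
  also have "\<dots> = dual_apply \<phi> v' - \<sigma> * \<beta> / 2" by (simp add: v'_eval algebra_simps)
  finally show False using \<psi>(2) by simp
qed

subsection \<open>Approximate subgradients near a point\<close>

text \<open>This is lower semicontinuity of \<open>h\<close> at an algebraic relative interior point
  \<open>z\<close> of its domain. \<open>h\<close> is bounded above near \<open>z\<close> within
  \<open>z + span B\<close>, and \<open>z\<close> is a convex combination of a nearby point
  \<open>y\<close> and a point on the opposite side with small weight, so a low value at
  \<open>y\<close> would force a low value at \<open>z\<close>.\<close>

lemma not_in_closure_epi:
  fixes h :: "'a \<Rightarrow> ereal"
  assumes "convex_fun h" and r: "ereal r < h z"
    and dom: "\<And>y. h y < \<infinity> \<Longrightarrow> y - z \<in> span B"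
    and core: "\<And>u. u \<in> span B \<Longrightarrow> \<exists>\<tau>>0. h (z + \<tau> *\<^sub>R u) < \<infinity>"
  shows "(z, r) \<notin> closure (epi h)"
proof
  assume closure: "(z, r) \<in> closure (epi h)"
  have "convex (epi h)" using assms(1) by (simp add: convex_fun_def)
  have val: "\<exists>\<tau>>0. \<exists>m. h (z + \<tau> *\<^sub>R u) \<le> ereal m" if u: "u \<in> span B" for u
  proof -
    obtain \<tau> where "\<tau> > 0" "h (z + \<tau> *\<^sub>R u) < \<infinity>" using core[OF u] by blast
    moreover from this(2) have "\<exists>m. h (z + \<tau> *\<^sub>R u) \<le> ereal m"
      by (cases "h (z + \<tau> *\<^sub>R u)") auto
    ultimately show ?thesis by blast
  qed
  have "\<forall>b\<in>B. \<exists>\<tau> m. \<tau> > 0 \<and> h (z + \<tau> *\<^sub>R b) \<le> ereal m"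
    using val span_base by blast
  then obtain \<tau>1 m1 where 1: "\<And>b. b \<in> B \<Longrightarrow> \<tau>1 b > 0 \<and> h (z + \<tau>1 b *\<^sub>R b) \<le> ereal (m1 b)" by metis
  have "\<forall>b\<in>B. \<exists>\<tau> m. \<tau> > 0 \<and> h (z + \<tau> *\<^sub>R (- b)) \<le> ereal m"
    using val span_base span_neg by blast
  then obtain \<tau>2 m2 where 2: "\<And>b. b \<in> B \<Longrightarrow> \<tau>2 b > 0 \<and> h (z + \<tau>2 b *\<^sub>R (- b)) \<le> ereal (m2 b)" by metis
  obtain m0 where m0: "h z \<le> ereal m0" using val[OF span_zero] by auto
  \<comment> \<open>A common bound at \<open>z\<close> and at the points reached from
    \<open>z\<close> along \<open>b\<close> and \<open>- b\<close>; the sum of absolute values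
    replaces a maximum, also for empty \<open>B\<close>.\<close>
  define M where "M = \<bar>m0\<bar> + (\<Sum>b\<in>B. \<bar>m1 b\<bar> + \<bar>m2 b\<bar>)"
  have M: "m0 \<le> M" "\<And>b. b \<in> B \<Longrightarrow> m1 b \<le> M" "\<And>b. b \<in> B \<Longrightarrow> m2 b \<le> M"
  proof -
    have "0 \<le> (\<Sum>b\<in>B. \<bar>m1 b\<bar> + \<bar>m2 b\<bar>)" by (intro sum_nonneg) simp
    then show "m0 \<le> M" unfolding M_def by linarith
    fix b assume "b \<in> B"
    then have "\<bar>m1 b\<bar> + \<bar>m2 b\<bar> \<le> (\<Sum>b\<in>B. \<bar>m1 b\<bar> + \<bar>m2 b\<bar>)"
      by (rule member_le_sum) (auto simp: finite_B)
    then show "m1 b \<le> M" "m2 b \<le> M" unfolding M_def by linarith+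
  qed
  define S where "S = {u. (z + u, M) \<in> epi h}"
  have "convex S"
  proof (rule convexI)
    fix u w and p q :: real assume "u \<in> S" "w \<in> S" and pq: "p \<ge> 0" "q \<ge> 0" "p + q = 1"
    then have "p *\<^sub>R (z + u, M) + q *\<^sub>R (z + w, M) \<in> epi h"
      by (intro convexD[OF \<open>convex (epi h)\<close>]) (auto simp: S_def)
    moreover have "p *\<^sub>R (z + u, M) + q *\<^sub>R (z + w, M) = ((p + q) *\<^sub>R z + (p *\<^sub>R u + q *\<^sub>R w), (p + q) * M)"
      by (simp add: algebra_simps)
    ultimately show "p *\<^sub>R u + q *\<^sub>R w \<in> S" using pq by (simp add: S_def)
  qed
  have S0: "0 \<in> S" using m0 M(1) by (auto simp: S_def epi_def intro: order_trans)
  have S1: "\<tau>1 b *\<^sub>R b \<in> S" if "b \<in> B" for b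
    using 1[OF that] M(2)[OF that] by (auto simp: S_def epi_def intro: order_trans)
  have S2: "\<tau>2 b *\<^sub>R (- b) \<in> S" if "b \<in> B" for b
    using 2[OF that] M(3)[OF that] unfolding S_def epi_def by (auto intro: order_trans)
  define \<tau> where "\<tau> b = min (\<tau>1 b) (\<tau>2 b)" for b
  have \<tau>: "\<tau> b > 0" if "b \<in> B" for b using 1[OF that] 2[OF that] by (simp add: \<tau>_def)
  have scale: "c *\<^sub>R u \<in> S" if "u \<in> S" "0 \<le> c" "c \<le> 1" for c u
    using convexD[OF \<open>convex S\<close> that(1) S0, of c "1 - c"] that by simp
  have S\<tau>: "\<tau> b *\<^sub>R b \<in> S" "- (\<tau> b *\<^sub>R b) \<in> S" if "b \<in> B" for b
    using scale[OF S1[OF that], of "\<tau> b / \<tau>1 b"] scale[OF S2[OF that], of "\<tau> b / \<tau>2 b"]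
      1[OF that] 2[OF that] by (auto simp: \<tau>_def)
  \<comment> \<open>A weighted l1 norm in the coordinates; its unit ball in \<open>span B\<close>
    lies in \<open>S\<close>, being spanned by the points \<open>\<tau> b *\<^sub>R b\<close> and
    their negatives.\<close>
  define p where "p u = (\<Sum>b\<in>B. \<bar>dual_apply (d b) u\<bar> / \<tau> b)" for u
  have pS: "u \<in> S" if "u \<in> span B" "p u \<le> 1" for u
  proof -
    have "(\<Sum>b\<in>B. (\<bar>dual_apply (d b) u\<bar> / \<tau> b) *\<^sub>R (sgn (dual_apply (d b) u) *\<^sub>R \<tau> b *\<^sub>R b)) \<in> S"
    proof (rule convex_sub_sum[OF \<open>convex S\<close> S0 finite_B])
      fix b assume "b \<in> B"
      then show "0 \<le> \<bar>dual_apply (d b) u\<bar> / \<tau> b" using \<tau> by (simp add: less_imp_le)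
      show "sgn (dual_apply (d b) u) *\<^sub>R \<tau> b *\<^sub>R b \<in> S"
        using S\<tau>[OF \<open>b \<in> B\<close>] S0 by (simp add: sgn_if)
    qed (use that(2) in \<open>simp add: p_def\<close>)
    also have "(\<Sum>b\<in>B. (\<bar>dual_apply (d b) u\<bar> / \<tau> b) *\<^sub>R (sgn (dual_apply (d b) u) *\<^sub>R \<tau> b *\<^sub>R b))
        = (\<Sum>b\<in>B. dual_apply (d b) u *\<^sub>R b)"
    proof (intro sum.cong refl)
      fix b assume "b \<in> B"
      with \<tau>[of b] show "(\<bar>dual_apply (d b) u\<bar> / \<tau> b) *\<^sub>R (sgn (dual_apply (d b) u) *\<^sub>R \<tau> b *\<^sub>R b)
          = dual_apply (d b) u *\<^sub>R b"
        by (simp add: abs_mult_sgn)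
    qed
    finally show ?thesis by (simp add: span_expansion[OF that(1)])
  qed
  obtain r' where r': "r < r'" "ereal r' < h z"
    using ereal_dense2[OF r] by auto
  define \<kappa> where "\<kappa> = (r' - r) / 2"
  have \<kappa>: "\<kappa> > 0" "r' = r + \<kappa> + \<kappa>" using r'(1) by (auto simp: \<kappa>_def field_simps)
  \<comment> \<open>As the weight of the point with value at most \<open>M\<close>, \<theta> raises
    the bound \<open>r + \<kappa>\<close> by at most \<kappa>. The summand
    \<open>2 * \<kappa>\<close> ensures \<open>\<theta> < 1\<close>.\<close>
  define \<theta> where "\<theta> = \<kappa> / (\<bar>M - r - \<kappa>\<bar> + 2 * \<kappa>)"
  have \<theta>: "\<theta> > 0" "\<theta> < 1" using \<kappa>(1) by (auto simp: \<theta>_def field_simps)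
  have "\<theta> * (M - r - \<kappa>) \<le> \<theta> * (\<bar>M - r - \<kappa>\<bar> + 2 * \<kappa>)" using \<theta> \<kappa>(1) by (intro mult_left_mono) auto
  also have "\<dots> = \<kappa>" using \<kappa>(1) by (simp add: \<theta>_def)
  finally have \<theta>M: "\<theta> * (M - r - \<kappa>) \<le> \<kappa>" .
  let ?U = "(\<lambda>y. p (y - z)) -` {..<\<theta>} \<times> {..<r + \<kappa>}"
  have "continuous_on UNIV (\<lambda>y. p (y - z))"
    unfolding p_def divide_inverse
    by (intro continuous_on_sum continuous_on_mult_right continuous_on_rabs
        continuous_on_compose2[OF continuous_on_dual_apply] continuous_intros) auto
  then have "open ?U" by (intro open_Times open_vimage open_lessThan)
  moreover have "(z, r) \<in> ?U" using \<theta> \<kappa>(1) by (simp add: p_def dual_apply_simps)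
  ultimately obtain y q where yq: "(y, q) \<in> epi h" "(y, q) \<in> ?U"
    using closure unfolding closure_iff_nhds_not_empty by (metis Int_iff ex_in_conv subset_refl surj_pair)
  have "h y < \<infinity>" using yq(1) by (auto simp: epi_def intro: le_less_trans)
  then have ys: "y - z \<in> span B" by (rule dom)
  \<comment> \<open>The direction opposite to \<open>y - z\<close>, scaled so that
    \<open>(1 - \<theta>) *\<^sub>R y + \<theta> *\<^sub>R (z + u) = z\<close>;
    \<open>p (y - z) < \<theta>\<close> keeps \<open>u\<close> in the unit ball of
    \<open>p\<close>.\<close>
  define u where "u = - (((1 - \<theta>) / \<theta>) *\<^sub>R (y - z))"
  have "p u = ((1 - \<theta>) / \<theta>) * p (y - z)"
    using \<theta> by (simp add: p_def u_def dual_apply_simps abs_mult sum_distrib_left)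
  also have "\<dots> \<le> ((1 - \<theta>) / \<theta>) * \<theta>" using yq(2) \<theta> by (intro mult_left_mono) auto
  also have "\<dots> \<le> 1" using \<theta> by simp
  finally have "p u \<le> 1" .
  moreover have "u \<in> span B" unfolding u_def by (intro span_neg span_scale ys)
  ultimately have "u \<in> S" by (intro pS)
  then have "(1 - \<theta>) *\<^sub>R (y, q) + \<theta> *\<^sub>R (z + u, M) \<in> epi h"
    using yq(1) \<theta> by (intro convexD[OF \<open>convex (epi h)\<close>]) (auto simp: S_def)
  moreover have "\<theta> *\<^sub>R u = - ((1 - \<theta>) *\<^sub>R (y - z))" using \<theta> by (simp add: u_def)
  then have "(1 - \<theta>) *\<^sub>R y + \<theta> *\<^sub>R (z + u) = z" by (simp add: algebra_simps)
  ultimately have "h z \<le> ereal ((1 - \<theta>) * q + \<theta> * M)" by (simp add: epi_def)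
  moreover have "(1 - \<theta>) * q \<le> (1 - \<theta>) * (r + \<kappa>)" using yq(2) \<theta> by (intro mult_left_mono) auto
  then have "(1 - \<theta>) * q + \<theta> * M \<le> r'" using \<theta>M \<kappa>(2) by (simp add: algebra_simps)
  ultimately have "h z \<le> ereal r'" by (meson ereal_less_eq(3) order_trans)
  then show False using r'(2) by simp
qed

end

text \<open>Taking the basis inside \<open>S\<close> makes its vectors usable as points of
  \<open>S\<close>, both in convex combinations and in the upper bounds on approximate
  subgradients.\<close>

lemma ex_dual_basis:
  fixes S :: "'a::locally_convex_space set"
  assumes "finite F" "S \<subseteq> span F"
  obtains B d where "dual_basis B d" "B \<subseteq> S" "span B = span S"
proof -
  obtain B where B: "B \<subseteq> S" "independent B" "S \<subseteq> span B"
    using maximal_independent_subset[of S] by metis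
  have "finite B" using independent_span_bound[OF assms(1) B(2)] B(1) assms(2) by blast
  then obtain d where "dual_basis B d" using ex_biorthogonal[OF _ B(2)] unfolding dual_basis_def by blast
  moreover have "span B = span S"
    using B by (metis span_mono span_span subset_antisym)
  ultimately show thesis using that B(1) by blast
qed

text \<open>With \<open>k = dual_apply \<psi> v\<close>, evaluating the minorant at \<open>x\<close>
  bounds \<open>k\<close> below by \<open>m - \<delta> / s\<close>, and evaluating it at
  \<open>x + v\<close> bounds \<open>k\<close> above independently of \<open>s\<close>. The upper
  bound makes the minorant at least \<open>fx - \<epsilon>\<close> at \<open>x\<close>, which gives
  both activity of \<open>t\<close> and the subgradient inequality.\<close>

lemma near_active_eps_subgradient:
  fixes ft g :: "'i \<Rightarrow> 'a::locally_convex_space \<Rightarrow> ereal"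
  assumes f: "\<And>x. f x = (SUP t\<in>T. ft t x)"
    and fx: "f x = ereal fx" and fv: "f (x + v) \<le> ereal fv"
    and g: "\<And>t. t \<in> T \<Longrightarrow> g t x = ft t x" "\<And>t. t \<in> T \<Longrightarrow> g t (x + v) = ft t (x + v)"
    and minorant: "\<And>s \<delta>. 0 < s \<Longrightarrow> s \<le> 1 / 2 \<Longrightarrow> 0 < \<delta> \<Longrightarrow> \<exists>t\<in>T. \<exists>\<psi>. \<forall>y.
      ereal (fx + s * m - \<delta> + dual_apply \<psi> (y - (x + s *\<^sub>R v))) \<le> g t y"
    and "\<epsilon> > 0" "\<beta> > 0"
  shows "\<exists>t\<in>active_indices T ft f \<epsilon> x. \<exists>\<psi>\<in>eps_subdiff \<epsilon> (g t) x. dual_apply \<psi> v > m - \<beta>"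
proof -
  \<comment> \<open>The factor 2 compensates \<open>1 - s \<ge> 1 / 2\<close> in the bound of
    \<open>k\<close> by \<open>C\<close>. Then \<open>s\<close> makes
    \<open>s * (\<bar>m\<bar> + C)\<close> at most \<open>\<epsilon> / 2\<close>, and \<delta> takes
    the other half of \<epsilon> while staying below \<open>s * \<beta>\<close>.\<close>
  define C where "C = 2 * (\<bar>fv - fx\<bar> + \<bar>m\<bar> + 1)"
  define s where "s = min (1 / 2) (\<epsilon> / (2 * (\<bar>m\<bar> + C + 1)))"
  define \<delta> where "\<delta> = min 1 (min (\<epsilon> / 2) (s * \<beta> / 2))"
  have "C \<ge> 0" by (simp add: C_def)
  then have s: "0 < s" "s \<le> 1 / 2" using \<open>\<epsilon> > 0\<close> unfolding s_def by (simp, intro min.cobounded1)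
  have "s * (\<bar>m\<bar> + C) \<le> s * (\<bar>m\<bar> + C + 1)" using s by (intro mult_left_mono) auto
  also have "\<dots> \<le> \<epsilon> / (2 * (\<bar>m\<bar> + C + 1)) * (\<bar>m\<bar> + C + 1)"
    using \<open>C \<ge> 0\<close> by (intro mult_right_mono) (auto simp: s_def)
  also have "\<dots> = \<epsilon> / 2" using \<open>C \<ge> 0\<close> by (simp add: field_simps)
  finally have s\<epsilon>: "s * (\<bar>m\<bar> + C) \<le> \<epsilon> / 2" .
  have \<delta>: "0 < \<delta>" "\<delta> \<le> 1" "\<delta> \<le> \<epsilon> / 2" "\<delta> < s * \<beta>"
    using \<open>\<epsilon> > 0\<close> \<open>\<beta> > 0\<close> s by (auto simp: \<delta>_def min_less_iff_disj)
  obtain t \<psi> where t: "t \<in> T" and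
    \<psi>: "\<And>y. ereal (fx + s * m - \<delta> + dual_apply \<psi> (y - (x + s *\<^sub>R v))) \<le> g t y"
    using minorant[OF s \<delta>(1)] by blast
  define k where "k = dual_apply \<psi> v"
  have \<psi>': "ereal (fx + s * m - \<delta> + dual_apply \<psi> (y - x) - s * k) \<le> g t y" for y
    using \<psi>[of y] by (simp add: k_def dual_apply_simps algebra_simps)
  have ftf: "ft t y \<le> f y" for y unfolding f by (rule SUP_upper[OF t])
  have at_x: "ereal (fx + s * m - \<delta> - s * k) \<le> ft t x"
    using \<psi>'[of x] g(1)[OF t] by (simp add: dual_apply_simps)
  have "ereal (fx + s * m - \<delta> - s * k) \<le> ereal fx"
    using at_x ftf[of x] unfolding fx by (rule order_trans)
  then have "s * (m - k) \<le> \<delta>" by (simp add: algebra_simps)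
  also have "\<dots> < s * \<beta>" by (rule \<delta>(4))
  finally have k: "k > m - \<beta>" using s(1) by simp
  have "ereal (fx + s * m - \<delta> + k - s * k) \<le> ereal fv"
    using order_trans[OF \<psi>'[of "x + v", unfolded g(2)[OF t]] order_trans[OF ftf fv]] by (simp add: k_def)
  then have "(1 - s) * k \<le> fv - fx - s * m + \<delta>" by (simp add: algebra_simps)
  also have "\<dots> \<le> \<bar>fv - fx\<bar> + \<bar>m\<bar> + 1"
  proof -
    have "\<bar>s * m\<bar> \<le> 1 * \<bar>m\<bar>" unfolding abs_mult using s by (intro mult_right_mono) auto
    then show ?thesis using \<delta>(2) by linarith
  qed
  finally have "(1 - s) * k \<le> C / 2" by (simp add: C_def)
  moreover have "1 / 2 * k \<le> (1 - s) * k" if "k \<ge> 0" using that s by (intro mult_right_mono) auto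
  ultimately have kC: "k \<le> C" using \<open>C \<ge> 0\<close> by linarith
  have "s * m - \<delta> - s * k \<ge> - \<epsilon>"
  proof -
    have "s * k \<le> s * C" "- (s * m) \<le> s * \<bar>m\<bar>" using kC s by (auto simp: abs_if)
    then show ?thesis using s\<epsilon> \<delta>(3) by (simp add: distrib_left)
  qed
  then have low: "fx - \<epsilon> \<le> fx + s * m - \<delta> - s * k" by simp
  have "ereal (fx - \<epsilon>) \<le> ft t x" using low at_x by (meson ereal_less_eq(3) order_trans)
  then have "t \<in> active_indices T ft f \<epsilon> x" using t by (simp add: active_indices_def fx)
  obtain a where a: "ft t x = ereal a" "a \<le> fx"
    using at_x ftf[of x] fx by (cases "ft t x") auto
  have "g t x + ereal (dual_apply \<psi> (y - x)) - ereal \<epsilon> \<le> g t y" for y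
  proof -
    have "ereal (a + dual_apply \<psi> (y - x) - \<epsilon>) \<le> ereal (fx + s * m - \<delta> + dual_apply \<psi> (y - x) - s * k)"
      using low a(2) by simp
    from order_trans[OF this \<psi>'] show ?thesis by (simp add: g(1)[OF t] a(1))
  qed
  then have "\<psi> \<in> eps_subdiff \<epsilon> (g t) x" by (simp add: eps_subdiff_def g(1)[OF t] a(1))
  then show ?thesis using \<open>t \<in> active_indices T ft f \<epsilon> x\<close> k by (auto simp: k_def)
qed

subsection \<open>Subdifferentials of suprema\<close>

lemma convex_fun_SUP:
  assumes "\<And>t. t \<in> T \<Longrightarrow> convex_fun (ft t)" and f: "\<And>x. f x = (SUP t\<in>T. ft t x)"
  shows "convex_fun f"
proof -
  have "epi f = (\<Inter>t\<in>T. epi (ft t))" by (auto simp: epi_def f SUP_le_iff)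
  then show ?thesis using assms(1) by (auto simp: convex_fun_def intro: convex_INT)
qed

lemma convex_effdom:
  assumes "convex_fun h"
  shows "convex (effdom h)"
proof -
  have "effdom h = fst ` epi h"
  proof (intro equalityI subsetI)
    fix x assume "x \<in> effdom h"
    then obtain r where "h x \<le> ereal r" by (cases "h x") (auto simp: effdom_def)
    then show "x \<in> fst ` epi h" by (force simp: epi_def)
  qed (auto simp: epi_def effdom_def intro: le_less_trans)
  then show ?thesis
    using assms by (auto simp: convex_fun_def intro!: convex_linear_image linear_fst)
qed

lemma convex_fun_restrict:
  assumes "convex_fun h" "convex D"
  shows "convex_fun (\<lambda>y. h y + indicator_fun D y)"
proof -
  have "epi (\<lambda>y. h y + indicator_fun D y) = epi h \<inter> D \<times> UNIV"
    by (auto simp: epi_def indicator_fun_def split: if_splits)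
  then show ?thesis
    using assms by (simp add: convex_fun_def convex_Int convex_Times)
qed

lemma mem_eps_subdiff_iff:
  "\<phi> \<in> eps_subdiff \<epsilon> h x \<longleftrightarrow>
    \<bar>h x\<bar> \<noteq> \<infinity> \<and> (\<forall>y. h x + ereal (dual_apply \<phi> (y - x)) - ereal \<epsilon> \<le> h y)"
  by (simp add: eps_subdiff_def)

lemma subdiff_finite:
  assumes "\<phi> \<in> subdiff f x"
  shows "\<exists>r. f x = ereal r \<and> (\<forall>y. ereal (r + dual_apply \<phi> (y - x)) \<le> f y)"
proof -
  have "\<bar>f x\<bar> \<noteq> \<infinity>" using assms by (auto simp: subdiff_def eps_subdiff_def split: if_splits)
  then obtain r where r: "f x = ereal r" by auto
  then have "ereal (r + dual_apply \<phi> (y - x)) \<le> f y" for y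
    using assms by (auto simp: subdiff_def eps_subdiff_def zero_ereal_def[symmetric] split: if_splits)
  then show ?thesis using r by blast
qed

text \<open>The first formula has no explicit normal cone; this absorption lets it share the
  argument of the second.\<close>

lemma eps_subdiff_add_normal_cone:
  assumes \<psi>: "\<psi> \<in> eps_subdiff \<epsilon> (\<lambda>y. h y + indicator_fun D y) x" and \<nu>: "\<nu> \<in> normal_cone D x"
  shows "\<psi> + \<nu> \<in> eps_subdiff \<epsilon> (\<lambda>y. h y + indicator_fun D y) x"
proof -
  have "x \<in> D" and \<nu>D: "\<And>y. y \<in> D \<Longrightarrow> dual_apply \<nu> (y - x) \<le> 0"
    using \<nu> by (auto simp: normal_cone_def split: if_splits)
  have fin: "\<bar>h x\<bar> \<noteq> \<infinity>" and
    le: "\<And>y. h x + ereal (dual_apply \<psi> (y - x)) - ereal \<epsilon> \<le> h y + indicator_fun D y"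
    using \<psi> \<open>x \<in> D\<close> by (auto simp: eps_subdiff_def indicator_fun_def split: if_splits)
  obtain a where a: "h x = ereal a" using fin by auto
  have "h x + ereal (dual_apply (\<psi> + \<nu>) (y - x)) - ereal \<epsilon> \<le> h y + indicator_fun D y" for y
  proof (cases "y \<in> D")
    case True
    have "ereal (a + dual_apply (\<psi> + \<nu>) (y - x) - \<epsilon>) \<le> ereal (a + dual_apply \<psi> (y - x) - \<epsilon>)"
      using \<nu>D[OF True] by (simp add: plus_dual.rep_eq)
    from order_trans[OF this] le[of y] show ?thesis by (simp add: a)
  qed (simp add: indicator_fun_def)
  then show ?thesis using \<open>x \<in> D\<close> fin by (simp add: eps_subdiff_def indicator_fun_def)
qed

text \<open>One \<epsilon> is lost by activity of \<open>t\<close> at \<open>x\<close> and one by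
  the subgradient inequality. Finiteness of \<open>f x\<close> also follows from activity.\<close>

lemma active_eps_subgradient_bound:
  assumes f: "\<And>x. f x = (SUP t\<in>T. ft t x)"
    and t: "t \<in> active_indices T ft f \<epsilon> x" and \<psi>: "\<psi> \<in> eps_subdiff \<epsilon> (g t) x"
    and g: "g t x = ft t x" "g t y = ft t y"
  shows "\<bar>f x\<bar> \<noteq> \<infinity>" and "f x + ereal (dual_apply \<psi> (y - x)) - ereal (2 * \<epsilon>) \<le> f y"
proof -
  have "t \<in> T" and act: "f x - ereal \<epsilon> \<le> ft t x" using t by (auto simp: active_indices_def)
  then have le: "ft t z \<le> f z" for z unfolding f by (intro SUP_upper)
  have "\<bar>ft t x\<bar> \<noteq> \<infinity>" and sub: "ft t x + ereal (dual_apply \<psi> (y - x)) - ereal \<epsilon> \<le> ft t y"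
    using \<psi> by (auto simp only: eps_subdiff_def g[symmetric] mem_Collect_eq empty_iff split: if_splits)
  then obtain a where a: "ft t x = ereal a" by auto
  then show fx: "\<bar>f x\<bar> \<noteq> \<infinity>" using act le[of x] by (cases "f x") auto
  then obtain r where r: "f x = ereal r" by auto
  have "ereal (r + dual_apply \<psi> (y - x) - 2 * \<epsilon>) \<le> ereal (a + dual_apply \<psi> (y - x) - \<epsilon>)"
    using act by (simp add: r a)
  also have "\<dots> \<le> f y" using order_trans[OF sub le] by (simp add: a)
  finally show "f x + ereal (dual_apply \<psi> (y - x)) - ereal (2 * \<epsilon>) \<le> f y" by (simp add: r)
qed

text \<open>Each \<open>y\<close> is tested with the subspace spanned by \<open>x\<close> and
  \<open>y\<close>. The inequality at \<open>y\<close> passes to weak-star closures up to an error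
  that vanishes with \<epsilon>, so the intersection lies in a half-space, which contains the convex
  hull as well.\<close>

lemma hull_closures_subset_subdiff:
  fixes A :: "'a::locally_convex_space set \<Rightarrow> real \<Rightarrow> 'a dual set"
  assumes bound: "\<And>L \<epsilon> \<psi>. L \<in> fin_dim_subspaces x \<Longrightarrow> 0 < \<epsilon> \<Longrightarrow> \<psi> \<in> A L \<epsilon> \<Longrightarrow> \<bar>f x\<bar> \<noteq> \<infinity> \<and>
      (\<forall>y\<in>L \<inter> effdom f. f x + ereal (dual_apply \<psi> (y - x)) - ereal (2 * \<epsilon>) \<le> f y)"
  shows "(\<Inter>L\<in>fin_dim_subspaces x. convex hull
      (\<Inter>\<epsilon>\<in>{0<..}. weak_star_topology closure_of A L \<epsilon>)) \<subseteq> subdiff f x"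
proof
  fix \<phi> assume "\<phi> \<in> (\<Inter>L\<in>fin_dim_subspaces x. convex hull
      (\<Inter>\<epsilon>\<in>{0<..}. weak_star_topology closure_of A L \<epsilon>))"
  then have \<phi>: "\<phi> \<in> convex hull (\<Inter>\<epsilon>\<in>{0<..}. weak_star_topology closure_of A L \<epsilon>)"
    if "L \<in> fin_dim_subspaces x" for L using that by blast
  have L: "span {x, y} \<in> fin_dim_subspaces x" for y
    by (auto simp: fin_dim_subspaces_def intro!: exI[of _ "{x, y}"] span_base)
  \<comment> \<open>Finiteness of \<open>f x\<close> is not given: it is read off from some element
    of \<open>A\<close>, which exists because the hull containing \<open>\<phi>\<close> is
    nonempty.\<close>
  have "(\<Inter>\<epsilon>\<in>{0<..}. weak_star_topology closure_of A (span {x, x}) \<epsilon>) \<noteq> {}"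
    using \<phi>[OF L[of x]] by (metis convex_hull_empty empty_iff)
  then obtain \<omega> where "\<omega> \<in> (\<Inter>\<epsilon>\<in>{0<..}. weak_star_topology closure_of A (span {x, x}) \<epsilon>)"
    by (meson ex_in_conv)
  then have "\<omega> \<in> weak_star_topology closure_of A (span {x, x}) 1" by (rule INT_D) simp
  then obtain \<psi> where \<psi>: "\<psi> \<in> A (span {x, x}) 1" using weak_star_closure_approx[of _ _ 1] by (metis zero_less_one)
  have fx: "\<bar>f x\<bar> \<noteq> \<infinity>" using bound[OF L zero_less_one \<psi>] by (rule conjunct1)
  then obtain r where r: "f x = ereal r" by auto
  have "f x + ereal (dual_apply \<phi> (y - x)) - ereal 0 \<le> f y" for y
  proof (cases "f y = \<infinity>")
    case False
    let ?L = "span {x, y}"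
    have y: "y \<in> ?L \<inter> effdom f" using False by (auto simp: effdom_def intro: span_base)
    have le: "ereal (r + dual_apply \<psi> (y - x) - 2 * \<epsilon>) \<le> f y" if "\<epsilon> > 0" "\<psi> \<in> A ?L \<epsilon>" for \<epsilon> \<psi>
      using bound[OF L that] y by (auto simp: r)
    have "(\<Inter>\<epsilon>\<in>{0<..}. weak_star_topology closure_of A ?L \<epsilon>) \<noteq> {}"
      using \<phi>[OF L] by (metis convex_hull_empty empty_iff)
    then obtain \<omega> where "\<omega> \<in> (\<Inter>\<epsilon>\<in>{0<..}. weak_star_topology closure_of A ?L \<epsilon>)"
      by (meson ex_in_conv)
    then have "\<omega> \<in> weak_star_topology closure_of A ?L 1" by (rule INT_D) simp
    then obtain \<psi> where \<psi>: "\<psi> \<in> A ?L 1" using weak_star_closure_approx[of _ _ 1] by (metis zero_less_one)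
    obtain q where q: "f y = ereal q"
      using le[OF zero_less_one \<psi>] False by (cases "f y") auto
    let ?H = "(\<lambda>\<psi>. dual_apply \<psi> (y - x)) -` {..q - r}"
    have "(\<Inter>\<epsilon>\<in>{0<..}. weak_star_topology closure_of A ?L \<epsilon>) \<subseteq> ?H"
    proof
      fix \<omega> assume \<omega>: "\<omega> \<in> (\<Inter>\<epsilon>\<in>{0<..}. weak_star_topology closure_of A ?L \<epsilon>)"
      have "dual_apply \<omega> (y - x) \<le> q - r + e" if "e > 0" for e
      proof -
        \<comment> \<open>Level \<open>e / 3\<close> costs twice \<open>e / 3\<close> in the
          inequality, and the approximation costs the last third.\<close>
        have "\<omega> \<in> weak_star_topology closure_of A ?L (e / 3)" "e / 3 > 0" using \<omega> that by auto
        then obtain \<psi> where "\<psi> \<in> A ?L (e / 3)" "\<bar>dual_apply \<psi> (y - x) - dual_apply \<omega> (y - x)\<bar> < e / 3"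
          by (rule weak_star_closure_approx)
        moreover from le[OF \<open>e / 3 > 0\<close> this(1)] have "r + dual_apply \<psi> (y - x) - 2 * (e / 3) \<le> q"
          by (simp add: q)
        ultimately show ?thesis by linarith
      qed
      then show "\<omega> \<in> ?H" using field_le_epsilon[of "dual_apply \<omega> (y - x)" "q - r"] by simp
    qed
    moreover have "convex ?H" by (intro convex_linear_vimage linear_evaluation) simp
    ultimately have "\<phi> \<in> ?H" using \<phi>[OF L] hull_minimal[of _ ?H convex] by blast
    then show ?thesis by (simp add: q r)
  qed simp
  then show "\<phi> \<in> subdiff f x" using fx by (simp add: subdiff_def eps_subdiff_def)
qed

lemma active_indices_mono:
  assumes "\<epsilon> \<le> \<epsilon>'"
  shows "active_indices T ft f \<epsilon> x \<subseteq> active_indices T ft f \<epsilon>' x"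
proof -
  have "f x - ereal \<epsilon>' \<le> f x - ereal \<epsilon>" using assms by (intro ereal_minus_mono) auto
  then show ?thesis by (auto simp: active_indices_def elim: order_trans)
qed

lemma eps_subdiff_mono:
  assumes "\<epsilon> \<le> \<epsilon>'"
  shows "eps_subdiff \<epsilon> h x \<subseteq> eps_subdiff \<epsilon>' h x"
proof
  fix \<phi> assume \<phi>: "\<phi> \<in> eps_subdiff \<epsilon> h x"
  have "a - ereal \<epsilon>' \<le> a - ereal \<epsilon>" for a using assms by (intro ereal_minus_mono) auto
  then show "\<phi> \<in> eps_subdiff \<epsilon>' h x"
    using \<phi> unfolding mem_eps_subdiff_iff by (meson order_trans)
qed

text \<open>\<open>g\<close> stands for the restricted or the original functions, and the two
  formulas differ only in how \<open>minorant\<close> is obtained. That hypothesis concerns points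
  \<open>x + v\<close> in the algebraic relative interior of \<open>D\<close>. Adding the normal
  cone provides stability under the polar cone of \<open>D - x\<close>.\<close>

lemma subdiff_in_hull_closures:
  fixes ft g :: "'i \<Rightarrow> 'a::locally_convex_space \<Rightarrow> ereal"
  assumes f: "\<And>x. f x = (SUP t\<in>T. ft t x)" and D: "convex D" "D \<subseteq> effdom f" "x \<in> D"
    and fin: "finite F" "D \<subseteq> span F"
    and \<phi>: "\<phi> \<in> subdiff f x" and fx: "f x = ereal fx"
    and g: "\<And>t y. t \<in> T \<Longrightarrow> y \<in> D \<Longrightarrow> g t y = ft t y"
    and minorant: "\<And>v s \<delta>. x + v \<in> D \<Longrightarrow>
      (\<And>u. u \<in> span ((\<lambda>y. y - x) ` D) \<Longrightarrow> \<exists>\<tau>>0. x + v + \<tau> *\<^sub>R u \<in> D) \<Longrightarrow>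
      0 < s \<Longrightarrow> s \<le> 1 / 2 \<Longrightarrow> 0 < \<delta> \<Longrightarrow>
      \<exists>t\<in>T. \<exists>\<psi>. \<forall>y. ereal (fx + s * dual_apply \<phi> v - \<delta> + dual_apply \<psi> (y - (x + s *\<^sub>R v))) \<le> g t y"
  shows "\<phi> \<in> convex hull (\<Inter>\<epsilon>\<in>{0<..}. strong_topology closure_of
    ((\<Union>t\<in>active_indices T ft f \<epsilon> x. eps_subdiff \<epsilon> (g t) x) + normal_cone D x))"
proof -
  define S where "S = (\<lambda>y. y - x) ` D"
  define A where "A \<epsilon> = (\<Union>t\<in>active_indices T ft f \<epsilon> x. eps_subdiff \<epsilon> (g t) x) + normal_cone D x" for \<epsilon>
  have S_iff: "v \<in> S \<longleftrightarrow> x + v \<in> D" for v by (force simp: S_def image_iff)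
  have "convex S" unfolding S_def using D(1) convex_translation_subtract_eq by blast
  have "0 \<in> S" using D(3) by (simp add: S_iff)
  have "S \<subseteq> span F" using fin(2) D(3) by (auto simp: S_def intro!: span_diff)
  then obtain B d where "dual_basis B d" and B: "B \<subseteq> S" "span B = span S"
    using ex_dual_basis[OF fin(1)] by blast
  interpret dual_basis B d by fact
  have normal_iff: "\<nu> \<in> normal_cone D x \<longleftrightarrow> (\<forall>s\<in>S. dual_apply \<nu> s \<le> 0)" for \<nu>
    using D(3) by (auto simp: normal_cone_def S_def)
  have mono: "A \<epsilon> \<subseteq> A \<epsilon>'" if "0 < \<epsilon>" "\<epsilon> \<le> \<epsilon>'" for \<epsilon> \<epsilon>'
    unfolding A_def
    by (intro set_plus_mono2 UN_mono active_indices_mono[OF that(2)] eps_subdiff_mono[OF that(2)] order_refl)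
  have polar: "\<psi> + \<nu> \<in> A \<epsilon>" if "0 < \<epsilon>" and \<psi>: "\<psi> \<in> A \<epsilon>" and \<nu>: "\<forall>s\<in>S. dual_apply \<nu> s \<le> 0" for \<epsilon> \<psi> \<nu>
  proof -
    obtain \<psi>1 \<nu>1 where 1: "\<psi>1 \<in> (\<Union>t\<in>active_indices T ft f \<epsilon> x. eps_subdiff \<epsilon> (g t) x)"
      "\<nu>1 \<in> normal_cone D x" "\<psi> = \<psi>1 + \<nu>1" using \<psi> unfolding A_def by (rule set_plus_elim)
    then have "\<nu>1 + \<nu> \<in> normal_cone D x" using \<nu> by (fastforce simp: normal_iff plus_dual.rep_eq)
    then show ?thesis using 1 by (auto simp: A_def add.assoc)
  qed
  have bdd: "\<exists>C. \<forall>\<psi>\<in>A 1. dual_apply \<psi> s \<le> C" if s: "s \<in> S" for s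
  proof -
    obtain y where y: "y \<in> D" "s = y - x" using s by (auto simp: S_def)
    have "f y < \<infinity>" using y(1) D(2) by (auto simp: effdom_def)
    then obtain C where C: "f y \<le> ereal C" by (cases "f y") auto
    have "dual_apply \<psi> s \<le> C - fx + 2" if "\<psi> \<in> A 1" for \<psi>
    proof -
      obtain t \<psi>1 \<nu>1 where t: "t \<in> active_indices T ft f 1 x" "\<psi>1 \<in> eps_subdiff 1 (g t) x"
        and \<nu>1: "\<nu>1 \<in> normal_cone D x" "\<psi> = \<psi>1 + \<nu>1"
        using \<open>\<psi> \<in> A 1\<close> by (auto simp: A_def elim!: set_plus_elim)
      then have "t \<in> T" by (simp add: active_indices_def)
      then have "f x + ereal (dual_apply \<psi>1 s) - ereal (2 * 1) \<le> f y"
        unfolding y(2) using g y(1) D(3)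
        by (intro active_eps_subgradient_bound(2)[where g = g, OF f t]) auto
      from order_trans[OF this C] have "fx + dual_apply \<psi>1 s - 2 \<le> C" by (simp add: fx)
      moreover have "dual_apply \<nu>1 s \<le> 0" using \<nu>1(1) s by (simp add: normal_iff)
      ultimately show ?thesis by (simp add: \<nu>1(2) plus_dual.rep_eq)
    qed
    then show ?thesis by blast
  qed
  have core: "\<exists>\<psi>\<in>A \<epsilon>. dual_apply \<psi> v > dual_apply \<phi> v - \<beta>"
    if pos: "0 < \<epsilon>" "0 < \<beta>" and "v \<in> S" and u: "\<And>u. u \<in> span B \<Longrightarrow> \<exists>\<tau>>0. v + \<tau> *\<^sub>R u \<in> S" for \<epsilon> \<beta> v
  proof -
    have xv: "x + v \<in> D" using \<open>v \<in> S\<close> by (simp add: S_iff)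
    then have "f (x + v) < \<infinity>" using D(2) by (auto simp: effdom_def)
    then obtain fv where fv: "f (x + v) \<le> ereal fv" by (cases "f (x + v)") auto
    have u': "\<exists>\<tau>>0. x + v + \<tau> *\<^sub>R u \<in> D" if "u \<in> span ((\<lambda>y. y - x) ` D)" for u
      using u[of u] that unfolding B(2) S_iff by (simp add: S_def add.assoc)
    obtain t \<psi> where t: "t \<in> active_indices T ft f \<epsilon> x" "\<psi> \<in> eps_subdiff \<epsilon> (g t) x"
      "dual_apply \<psi> v > dual_apply \<phi> v - \<beta>"
      using near_active_eps_subgradient[OF f fx fv g[OF _ D(3)] g[OF _ xv] minorant[OF xv u'] pos]
      by blast
    have "\<psi> + 0 \<in> A \<epsilon>"
      unfolding A_def using t by (intro set_plus_intro) (auto simp: normal_iff zero_dual.rep_eq)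
    then show ?thesis using t(3) by auto
  qed
  have SB: "S \<subseteq> span B" by (simp add: B(2) span_superset)
  have approx: "\<exists>\<psi>\<in>convex hull (A \<epsilon>). \<forall>b\<in>B. \<bar>dual_apply \<psi> b - dual_apply \<phi> b\<bar> < e"
    if pos: "0 < \<epsilon>" "0 < e" for \<epsilon> e
    by (rule convex_hull_approx[of S A \<phi>]) (fact mono polar bdd core pos B(1) SB \<open>convex S\<close> \<open>0 \<in> S\<close>)+
  have "\<phi> \<in> convex hull (\<Inter>\<epsilon>\<in>{0<..}. strong_topology closure_of A \<epsilon>)"
    by (rule limit_in_convex_hull_closures[of S A \<phi>]) (fact mono polar bdd approx B(1) SB)+
  then show ?thesis by (simp add: A_def)
qed

text \<open>The point \<open>z\<close> inherits from \<open>x + v\<close> its position in the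
  relative interior of \<open>D\<close>, which is exactly the domain of the restricted function.
  That function therefore has no closure gap at \<open>z\<close>.\<close>

lemma restricted_minorant:
  fixes ft :: "'i \<Rightarrow> 'a::locally_convex_space \<Rightarrow> ereal"
  assumes f: "\<And>x. f x = (SUP t\<in>T. ft t x)" and ft: "\<And>t. t \<in> T \<Longrightarrow> convex_fun (ft t)"
    and D: "convex D" "D \<subseteq> effdom f" "x \<in> D" and fin: "finite F" "D \<subseteq> span F"
    and \<phi>: "\<And>y. ereal (fx + dual_apply \<phi> (y - x)) \<le> f y"
    and v: "x + v \<in> D" and core: "\<And>u. u \<in> span ((\<lambda>y. y - x) ` D) \<Longrightarrow> \<exists>\<tau>>0. x + v + \<tau> *\<^sub>R u \<in> D"
    and s: "0 < s" "s \<le> 1 / 2" and "0 < \<delta>"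
  shows "\<exists>t\<in>T. \<exists>\<psi>. \<forall>y. ereal (fx + s * dual_apply \<phi> v - \<delta> + dual_apply \<psi> (y - (x + s *\<^sub>R v)))
    \<le> ft t y + indicator_fun D y"
proof -
  define z where "z = x + s *\<^sub>R v"
  define r where "r = fx + s * dual_apply \<phi> v - \<delta>"
  have toward: "x + s *\<^sub>R w \<in> D" if "x + w \<in> D" for w
  proof -
    have "(1 - s) *\<^sub>R x + s *\<^sub>R (x + w) \<in> D" using D(1,3) that s by (intro convexD) auto
    then show ?thesis by (simp add: algebra_simps)
  qed
  have "z \<in> D" unfolding z_def by (rule toward[OF v])
  have "ereal r < ereal (fx + dual_apply \<phi> (z - x))"
    using \<open>0 < \<delta>\<close> by (simp add: r_def z_def dual_apply_simps)
  also have "\<dots> \<le> f z" by (rule \<phi>)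
  finally obtain t where t: "t \<in> T" "ereal r < ft t z" unfolding f less_SUP_iff by blast
  define h where "h y = ft t y + indicator_fun D y" for y
  have hD: "h y = ft t y" if "y \<in> D" for y using that by (simp add: h_def indicator_fun_def)
  have h_dom: "h y < \<infinity> \<longleftrightarrow> y \<in> D" for y
  proof
    show "y \<in> D" if "h y < \<infinity>" using that by (auto simp: h_def indicator_fun_def split: if_splits)
    assume "y \<in> D"
    then have "f y < \<infinity>" using D(2) by (auto simp: effdom_def)
    moreover have "ft t y \<le> f y" unfolding f by (rule SUP_upper[OF t(1)])
    ultimately show "h y < \<infinity>" unfolding hD[OF \<open>y \<in> D\<close>] by (rule le_less_trans[rotated])
  qed
  have h: "convex_fun h" unfolding h_def by (intro convex_fun_restrict ft t D)
  define S where "S = (\<lambda>y. y - x) ` D"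
  have "S \<subseteq> span F" using fin(2) D(3) by (auto simp: S_def intro!: span_diff)
  then obtain B d where "dual_basis B d" and B: "B \<subseteq> S" "span B = span S"
    using ex_dual_basis[OF fin(1)] by metis
  interpret dual_basis B d by fact
  have Sspan: "y - x \<in> span B" if "y \<in> D" for y
    unfolding B(2) using that by (intro span_base) (auto simp: S_def)
  have "(z, r) \<notin> closure (epi h)"
  proof (rule not_in_closure_epi[OF h])
    show "ereal r < h z" using t(2) by (simp add: hD[OF \<open>z \<in> D\<close>])
    show "y - z \<in> span B" if "h y < \<infinity>" for y
    proof -
      have "(y - x) - (z - x) \<in> span B" using that \<open>z \<in> D\<close> unfolding h_dom by (intro span_diff[OF Sspan Sspan])
      then show ?thesis by simp
    qed
    show "\<exists>\<tau>>0. h (z + \<tau> *\<^sub>R u) < \<infinity>" if u: "u \<in> span B" for u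
    proof -
      obtain \<tau> where "\<tau> > 0" "x + (v + \<tau> *\<^sub>R u) \<in> D"
        using core[of u] u by (auto simp: B(2) S_def add.assoc)
      from this(1) toward[OF this(2)] show ?thesis
        unfolding h_dom using s
        \<comment> \<open>Contraction towards \<open>x\<close> by the factor \<open>s\<close> maps
          the admissible point \<open>x + v + \<tau> *\<^sub>R u\<close> to
          \<open>z + (s * \<tau>) *\<^sub>R u\<close>.\<close>
        by (intro exI[of _ "s * \<tau>"]) (simp add: z_def scaleR_add_right add.assoc)
    qed
  qed
  then obtain \<psi> where "\<And>y. ereal (r + dual_apply \<psi> (y - z)) \<le> h y"
    using affine_minorant_at[OF h, of z r] h_dom \<open>z \<in> D\<close> by blast
  then show ?thesis using t(1) by (auto simp: r_def z_def h_def)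
qed

text \<open>The affine minorant given by \<open>\<phi>\<close> is continuous, hence also lies below
  \<open>closure_fun f\<close>. The hypothesis \<open>cl\<close> then selects an index
  \<open>t\<close> whose own closure exceeds \<open>r\<close> at \<open>z\<close>, replacing the
  relative interior argument.\<close>

lemma closure_minorant:
  fixes ft :: "'i \<Rightarrow> 'a::locally_convex_space \<Rightarrow> ereal"
  assumes f: "\<And>x. f x = (SUP t\<in>T. ft t x)" and ft: "\<And>t. t \<in> T \<Longrightarrow> convex_fun (ft t)"
    and cl: "closure_fun f = (\<lambda>x. SUP t\<in>T. closure_fun (ft t) x)"
    and \<phi>: "\<And>y. ereal (fx + dual_apply \<phi> (y - x)) \<le> f y"
    and z: "f (x + s *\<^sub>R v) < \<infinity>" and "0 < \<delta>"
  shows "\<exists>t\<in>T. \<exists>\<psi>. \<forall>y. ereal (fx + s * dual_apply \<phi> v - \<delta> + dual_apply \<psi> (y - (x + s *\<^sub>R v))) \<le> ft t y"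
proof -
  define z where "z = x + s *\<^sub>R v"
  define r where "r = fx + s * dual_apply \<phi> v - \<delta>"
  let ?H = "{p. fx + dual_apply \<phi> (fst p - x) \<le> snd p}"
  have "closed ?H"
    by (intro closed_Collect_le continuous_on_compose2[OF continuous_on_dual_apply] continuous_intros) auto
  moreover have "epi f \<subseteq> ?H"
  proof clarsimp
    fix y q assume "(y, q) \<in> epi f"
    then have "f y \<le> ereal q" by (simp add: epi_def)
    from order_trans[OF \<phi> this] show "fx + dual_apply \<phi> (y - x) \<le> q" by simp
  qed
  ultimately have H: "closure (epi f) \<subseteq> ?H" by (intro closure_minimal)
  have "ereal r < ereal (fx + dual_apply \<phi> (z - x))"
    using \<open>0 < \<delta>\<close> by (simp add: r_def z_def dual_apply_simps)
  also have "\<dots> \<le> closure_fun f z"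
  proof (rule ereal_le_real)
    fix q assume "closure_fun f z \<le> ereal q"
    then have "(z, q) \<in> closure (epi f)" unfolding epi_closure_fun[symmetric] by (simp add: epi_def)
    then show "ereal (fx + dual_apply \<phi> (z - x)) \<le> ereal q" using H by auto
  qed
  finally obtain t where t: "t \<in> T" "ereal r < closure_fun (ft t) z" unfolding cl less_SUP_iff by blast
  then have "(z, r) \<notin> epi (closure_fun (ft t))" by (simp add: epi_def)
  then have "(z, r) \<notin> closure (epi (ft t))" by (simp add: epi_closure_fun)
  moreover have "ft t z \<le> f z" unfolding f by (rule SUP_upper[OF t(1)])
  then have "ft t z < \<infinity>" using z unfolding z_def by (rule le_less_trans)
  ultimately obtain \<psi> where "\<And>y. ereal (r + dual_apply \<psi> (y - z)) \<le> ft t y"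
    using affine_minorant_at[OF ft[OF t(1)]] by blast
  then show ?thesis using t(1) by (auto simp: r_def z_def)
qed

theorem theorem11:
  fixes T :: "'i set"
    and ft :: "'i \<Rightarrow> 'a::locally_convex_space \<Rightarrow> ereal"
    and f :: "'a \<Rightarrow> ereal"
  assumes "T \<noteq> {}"
    and "\<And>t. t \<in> T \<Longrightarrow> convex_fun (ft t)"
    and "\<And>x. f x = (SUP t\<in>T. ft t x)"
  shows "(\<forall>x. subdiff f x =
            (\<Inter>L\<in>fin_dim_subspaces x. convex hull
              (\<Inter>\<epsilon>\<in>{0<..}. strong_topology closure_of
                (\<Union>t\<in>active_indices T ft f \<epsilon> x.
                   eps_subdiff \<epsilon> (\<lambda>y. ft t y + indicator_fun (L \<inter> effdom f) y) x))))
       \<and> (closure_fun f = (\<lambda>x. SUP t\<in>T. closure_fun (ft t) x) \<longrightarrow>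
          (\<forall>x. subdiff f x =
            (\<Inter>L\<in>fin_dim_subspaces x. convex hull
              (\<Inter>\<epsilon>\<in>{0<..}. weak_star_topology closure_of
                ((\<Union>t\<in>active_indices T ft f \<epsilon> x. eps_subdiff \<epsilon> (ft t) x)
                   + normal_cone (L \<inter> effdom f) x)))))"
proof (intro conjI allI impI)
  note ft = assms(2) and f = assms(3)
  have fin: "\<exists>F. finite F \<and> L \<inter> effdom f \<subseteq> span F" if "L \<in> fin_dim_subspaces x" for L x
    using that by (auto simp: fin_dim_subspaces_def)
  have D: "convex (L \<inter> effdom f)" if "L \<in> fin_dim_subspaces x" for L x
    using that
    by (intro convex_Int subspace_imp_convex convex_effdom convex_fun_SUP[OF ft f])
      (auto simp: fin_dim_subspaces_def)
  {
    fix x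
    define g where "g L t y = ft t y + indicator_fun (L \<inter> effdom f) y" for L t y
    define A where "A L \<epsilon> = (\<Union>t\<in>active_indices T ft f \<epsilon> x. eps_subdiff \<epsilon> (g L t) x)" for L \<epsilon>
    have gD: "g L t y = ft t y" if "y \<in> L \<inter> effdom f" for L t y
      using that by (simp add: g_def indicator_fun_def)
    have "subdiff f x = (\<Inter>L\<in>fin_dim_subspaces x. convex hull
        (\<Inter>\<epsilon>\<in>{0<..}. strong_topology closure_of A L \<epsilon>))" (is "_ = ?R")
    proof
      show "subdiff f x \<subseteq> ?R"
      proof
        fix \<phi> assume \<phi>: "\<phi> \<in> subdiff f x"
        then obtain fx where fx: "f x = ereal fx" and le: "\<And>y. ereal (fx + dual_apply \<phi> (y - x)) \<le> f y"
          using subdiff_finite by blast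
        show "\<phi> \<in> ?R"
        proof
          fix L assume L: "L \<in> fin_dim_subspaces x"
          let ?D = "L \<inter> effdom f"
          have xD: "x \<in> ?D" using L fx by (auto simp: fin_dim_subspaces_def effdom_def)
          obtain F where F: "finite F" "?D \<subseteq> span F" using fin[OF L] by blast
          have sub: "A L \<epsilon> + normal_cone ?D x \<subseteq> A L \<epsilon>" for \<epsilon>
            unfolding A_def g_def[abs_def]
            by (auto elim!: set_plus_elim intro: eps_subdiff_add_normal_cone)
          have "\<phi> \<in> convex hull (\<Inter>\<epsilon>\<in>{0<..}. strong_topology closure_of (A L \<epsilon> + normal_cone ?D x))"
            unfolding A_def
            by (rule subdiff_in_hull_closures[OF f D[OF L] Int_lower2 xD F \<phi> fx gD])
              (auto simp: g_def intro!: restricted_minorant[OF f ft D[OF L] Int_lower2 xD F le])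
          then show "\<phi> \<in> convex hull (\<Inter>\<epsilon>\<in>{0<..}. strong_topology closure_of A L \<epsilon>)"
            by (rule subsetD[OF hull_mono, rotated]) (intro INT_anti_mono order_refl closure_of_mono sub)
        qed
      qed
      have "?R \<subseteq> (\<Inter>L\<in>fin_dim_subspaces x. convex hull
          (\<Inter>\<epsilon>\<in>{0<..}. weak_star_topology closure_of A L \<epsilon>))"
        by (intro INT_anti_mono order_refl hull_mono strong_closure_subset_weak_star_closure)
      also have "\<dots> \<subseteq> subdiff f x"
      proof (rule hull_closures_subset_subdiff, intro conjI ballI)
        fix L \<epsilon> \<psi> assume "L \<in> fin_dim_subspaces x" "\<psi> \<in> A L \<epsilon>"
        then obtain t where t: "t \<in> active_indices T ft f \<epsilon> x" "\<psi> \<in> eps_subdiff \<epsilon> (g L t) x"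
          by (auto simp: A_def)
        \<comment> \<open>A nonempty subdifferential needs a finite value at \<open>x\<close>, which
          the indicator allows only inside the set.\<close>
        then have "x \<in> L \<inter> effdom f"
          by (auto simp: g_def mem_eps_subdiff_iff indicator_fun_def split: if_splits)
        note bound = active_eps_subgradient_bound[where g = "g L", OF f t gD[OF this] gD]
        show "\<bar>f x\<bar> \<noteq> \<infinity>" by (rule bound(1)) fact
        show "f x + ereal (dual_apply \<psi> (y - x)) - ereal (2 * \<epsilon>) \<le> f y" if "y \<in> L \<inter> effdom f" for y
          by (rule bound(2)[OF that])
      qed
      finally show "?R \<subseteq> subdiff f x" .
    qed
    then show "subdiff f x = (\<Inter>L\<in>fin_dim_subspaces x. convex hull
        (\<Inter>\<epsilon>\<in>{0<..}. strong_topology closure_of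
          (\<Union>t\<in>active_indices T ft f \<epsilon> x.
             eps_subdiff \<epsilon> (\<lambda>y. ft t y + indicator_fun (L \<inter> effdom f) y) x)))"
      by (simp add: A_def g_def[abs_def])
  next
    fix x
    assume cl: "closure_fun f = (\<lambda>x. SUP t\<in>T. closure_fun (ft t) x)"
    define A where "A L \<epsilon> = (\<Union>t\<in>active_indices T ft f \<epsilon> x. eps_subdiff \<epsilon> (ft t) x)
      + normal_cone (L \<inter> effdom f) x" for L \<epsilon>
    have "subdiff f x = (\<Inter>L\<in>fin_dim_subspaces x. convex hull
        (\<Inter>\<epsilon>\<in>{0<..}. weak_star_topology closure_of A L \<epsilon>))" (is "_ = ?R")
    proof
      show "subdiff f x \<subseteq> ?R"
      proof
        fix \<phi> assume \<phi>: "\<phi> \<in> subdiff f x"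
        then obtain fx where fx: "f x = ereal fx" and le: "\<And>y. ereal (fx + dual_apply \<phi> (y - x)) \<le> f y"
          using subdiff_finite by blast
        show "\<phi> \<in> ?R"
        proof
          fix L assume L: "L \<in> fin_dim_subspaces x"
          let ?D = "L \<inter> effdom f"
          have xD: "x \<in> ?D" using L fx by (auto simp: fin_dim_subspaces_def effdom_def)
          obtain F where F: "finite F" "?D \<subseteq> span F" using fin[OF L] by blast
          have seg: "f (x + s *\<^sub>R v) < \<infinity>" if "x + v \<in> ?D" "0 < s" "s \<le> 1 / 2" for v s
          proof -
            have "(1 - s) *\<^sub>R x + s *\<^sub>R (x + v) \<in> ?D" using that xD by (intro convexD[OF D[OF L]]) auto
            then show ?thesis by (simp add: effdom_def algebra_simps)
          qed
          \<comment> \<open>The argument gives strong closures here too; they are enlarged to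
            weak-star closures afterwards.\<close>
          have "\<phi> \<in> convex hull (\<Inter>\<epsilon>\<in>{0<..}. strong_topology closure_of A L \<epsilon>)"
            unfolding A_def
            by (rule subdiff_in_hull_closures[where g = ft, OF f D[OF L] Int_lower2 xD F \<phi> fx refl])
              (rule closure_minorant[OF f ft cl le seg])
          then show "\<phi> \<in> convex hull (\<Inter>\<epsilon>\<in>{0<..}. weak_star_topology closure_of A L \<epsilon>)"
            by (rule subsetD[OF hull_mono, rotated])
              (intro INT_anti_mono order_refl strong_closure_subset_weak_star_closure)
        qed
      qed
      show "?R \<subseteq> subdiff f x"
      proof (rule hull_closures_subset_subdiff)
        fix L \<epsilon> \<psi> assume "L \<in> fin_dim_subspaces x" "\<psi> \<in> A L \<epsilon>"
        then obtain t \<psi>1 \<nu> where t: "t \<in> active_indices T ft f \<epsilon> x" "\<psi>1 \<in> eps_subdiff \<epsilon> (ft t) x"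
          and \<nu>: "\<nu> \<in> normal_cone (L \<inter> effdom f) x" "\<psi> = \<psi>1 + \<nu>"
          by (auto simp: A_def elim!: set_plus_elim)
        note bound = active_eps_subgradient_bound[where g = ft, OF f t refl refl]
        obtain r where r: "f x = ereal r" using bound(1) by auto
        have "f x + ereal (dual_apply \<psi> (y - x)) - ereal (2 * \<epsilon>) \<le> f y" if "y \<in> L \<inter> effdom f" for y
        proof -
          have "dual_apply \<nu> (y - x) \<le> 0" using \<nu>(1) that by (auto simp: normal_cone_def split: if_splits)
          then have "ereal (r + dual_apply \<psi> (y - x) - 2 * \<epsilon>) \<le> ereal (r + dual_apply \<psi>1 (y - x) - 2 * \<epsilon>)"
            by (simp add: \<nu>(2) plus_dual.rep_eq)
          from order_trans[OF this] bound(2)[of y] show ?thesis by (simp add: r)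
        qed
        then show "\<bar>f x\<bar> \<noteq> \<infinity> \<and> (\<forall>y\<in>L \<inter> effdom f.
            f x + ereal (dual_apply \<psi> (y - x)) - ereal (2 * \<epsilon>) \<le> f y)"
          using bound(1) by blast
      qed
    qed
    then show "subdiff f x = (\<Inter>L\<in>fin_dim_subspaces x. convex hull
        (\<Inter>\<epsilon>\<in>{0<..}. weak_star_topology closure_of
          ((\<Union>t\<in>active_indices T ft f \<epsilon> x. eps_subdiff \<epsilon> (ft t) x) + normal_cone (L \<inter> effdom f) x)))"
      by (simp add: A_def)
  }
qed

end
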